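(* Let $q\in(0,1)$, let $\mathcal{A}=C(SU_q(2))$, and let $\pi$, $L_2(h)$, $D_1$, $D_2$, $\pi'$, $\mathscr{H}$, $D$ be as defined in the context. Let $\mathcal{K}_q$ be the two-sided ideal of $\mathcal{L}(\mathscr{H})$ (the bounded operators on $\mathscr{H}$) generated by the operator $$d^n_{ij}\mapsto q^n d^n_{ij},\qquad u^n_{ij}\mapsto q^n u^n_{ij},$$ and let $\mathcal{A}_f$ denote the $*$-subalgebra of $\mathcal{A}$ generated by $\alpha$ and $\beta$. Then there is a unitary $U: L_2(h)\oplus L_2(h)\rightarrow \mathscr{H}$ such that $$U(D_1\oplus |D_2|)U^{*} = D,$$ $$U(\pi(a)\oplus\pi(a))U^* -\pi'(a)\in \mathcal{K}_q\quad\text{for all } a\in\mathcal{A}_f .$$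
   Context: **The algebra.** $\mathcal{A}=C(SU_q(2))$ is the universal $C^*$-algebra generated by $\alpha,\beta$ subject to $\alpha^*\alpha+\beta^*\beta=I=\alpha\alpha^*+q^2\beta\beta^*$, $\alpha\beta=q\beta\alpha$, $\alpha\beta^*=q\beta^*\alpha$, $\beta^*\beta=\beta\beta^*$. Let $h$ be the Haar state of $SU_q(2)$, $L_2(h)$ its GNS space with cyclic vector $\Omega$, and $\pi:\mathcal{A}\to\mathcal{L}(L_2(h))$ the representation by left multiplication. **The basis of $L_2(h)$.** $\{e^{(n)}_{ij}: n\in\{0,\tfrac12,1,\ldots\},\ i,j\in\{-n,-n+1,\ldots,n\}\}$ is the standard orthonormal basis of $L_2(h)$ consisting of normalized matrix entries of the irreducible unitary representations of $SU_q(2)$, with $e^{(0)}_{00}=\Omega$, in which $\pi$ is given by $$\pi(\alpha)e^{(n)}_{ij}=a_+(n,i,j)\,e^{(n+1/2)}_{i-1/2,j-1/2}+a_-(n,i,j)\,e^{(n-1/2)}_{i-1/2,j-1/2},$$ $$\pi(\beta)e^{(n)}_{ij}=b_+(n,i,j)\,e^{(n+1/2)}_{i+1/2,j-1/2}+b_-(n,i,j)\,e^{(n-1/2)}_{i+1/2,j-1/2},$$ where $$a_+(n,i,j)=\left(q^{2(n+i)+2(n+j)+2}\frac{(1-q^{2n-2j+2})(1-q^{2n-2i+2})}{(1-q^{4n+2})(1-q^{4n+4})}\right)^{1/2},\quad a_-(n,i,j)=\left(\frac{(1-q^{2n+2j})(1-q^{2n+2i})}{(1-q^{4n})(1-q^{4n+2})}\right)^{1/2},$$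 $$b_+(n,i,j)=-\left(q^{2(n+j)}\frac{(1-q^{2n-2j+2})(1-q^{2n+2i+2})}{(1-q^{4n+2})(1-q^{4n+4})}\right)^{1/2},\quad b_-(n,i,j)=\left(q^{2(n+i)}\frac{(1-q^{2n+2j})(1-q^{2n-2i})}{(1-q^{4n})(1-q^{4n+2})}\right)^{1/2},$$ with $a_-(0,0,0)=b_-(0,0,0)=0$. **The operators $D_1,D_2$ on $L_2(h)$** are the self-adjoint operators, diagonal in this basis, with $D_1e^{(n)}_{ij}=-2n\,e^{(n)}_{ij}$ if $j\neq n$, $D_1e^{(n)}_{in}=(2n+1)e^{(n)}_{in}$; $D_2e^{(n)}_{ij}=(-2n-1)e^{(n)}_{ij}$ if $j\ne n$, $D_2e^{(n)}_{in}=(2n+1)e^{(n)}_{in}$. **The Hilbert space $\mathscr{H}$.** $\mathscr{H}=W_0^\uparrow\oplus\bigoplus_{n=\frac12,1,\frac32,\ldots}(W_n^\uparrow\oplus W_n^\downarrow)$, where $W_n^\uparrow$ has orthonormal basis $\{u^n_{ij}: i=-n,-n+1,\ldots,n;\ j=-n-\frac12,-n+\frac12,\ldots,n+\frac12\}$ and $W_n^\downarrow$ has orthonormal basis $\{d^n_{ij}: i=-n,\ldots,n;\ j=-n+\frac12,-n+\frac32,\ldots,n-\frac12\}$. **The representation $\pi'$ of $\mathcal{A}$ on $\mathscr{H}$.** Write $v^n_{ij}=\begin{pmatrix}u^n_{ij}\\ d^n_{ij}\end{pmatrix}$, with $d^n_{ij}=0$ for $j=\pm(n+\frac12)$ (vectors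 with indices out of range are $0$). Then $$\pi'(\alpha^{*})v^n_{ij}=a^+_{nij}v^{n+1/2}_{i+1/2,j+1/2}+a^-_{nij}v^{n-1/2}_{i+1/2,j+1/2},\qquad \pi'(-\beta)v^n_{ij}=b^+_{nij}v^{n+1/2}_{i+1/2,j-1/2}+b^-_{nij}v^{n-1/2}_{i+1/2,j-1/2},$$ $$\pi'(\alpha)v^n_{ij}=\tilde a^+_{nij}v^{n+1/2}_{i-1/2,j-1/2}+\tilde a^-_{nij}v^{n-1/2}_{i-1/2,j-1/2},\qquad \pi'(-\beta^* )v^n_{ij}=\tilde b^+_{nij}v^{n+1/2}_{i-1/2,j+1/2}+\tilde b^-_{nij}v^{n-1/2}_{i-1/2,j+1/2}.$$ Here a $2\times2$ matrix $m=(m_{kl})$ in front of $v^{n'}_{i'j'}$ is the matrix of the corresponding component of the operator, with columns indexed by the source ($u$ first, $d$ second) and rows by the target: the component sends $u^n_{ij}\mapsto m_{11}u^{n'}_{i'j'}+m_{21}d^{n'}_{i'j'}$ and $d^n_{ij}\mapsto m_{12}u^{n'}_{i'j'}+m_{22}d^{n'}_{i'j'}$. With $[m]=\frac{q^m-q^{-m}}{q-q^{-1}}$, the matrices are $$a^+_{nij}=q^{(i+j-\frac12)/2}[n+i+1]^{1/2}\begin{pmatrix}q^{-n-\frac12}\frac{[n+j+\frac32]^{1/2}}{[2n+2]}&0\\ q^{\frac12}\frac{[n-j+\frac12]^{1/2}}{[2n+1][2n+2]}&q^{-n}\frac{[n+j+\frac12]^{1/2}}{[2n+1]}\end{pmatrix},$$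 $$a^-_{nij}=q^{(i+j-\frac12)/2}[n-i]^{1/2}\begin{pmatrix}q^{n+1}\frac{[n-j+\frac12]^{1/2}}{[2n+1]}&-q^{\frac12}\frac{[n+j+\frac12]^{1/2}}{[2n][2n+1]}\\ 0&q^{n+\frac12}\frac{[n-j-\frac12]^{1/2}}{[2n]}\end{pmatrix},$$ $$b^+_{nij}=q^{(i+j-\frac12)/2}[n+i+1]^{1/2}\begin{pmatrix}\frac{[n-j+\frac32]^{1/2}}{[2n+2]}&0\\ -q^{-n-1}\frac{[n+j+\frac12]^{1/2}}{[2n+1][2n+2]}&q^{-\frac12}\frac{[n-j+\frac12]^{1/2}}{[2n+1]}\end{pmatrix},$$ $$b^-_{nij}=q^{(i+j-\frac12)/2}[n-i]^{1/2}\begin{pmatrix}-q^{-\frac12}\frac{[n+j+\frac12]^{1/2}}{[2n+1]}&-q^{n}\frac{[n-j+\frac12]^{1/2}}{[2n][2n+1]}\\ 0&-\frac{[n+j-\frac12]^{1/2}}{[2n]}\end{pmatrix},$$ and $\tilde a^\pm_{nij}=(a^\mp_{n\pm\frac12,i-\frac12,j-\frac12})^*$, $\tilde b^\pm_{nij}=(b^\mp_{n\pm\frac12,i-\frac12,j+\frac12})^*$ (hermitian conjugates). Matrix entries referring to nonexistent source or target basis vectors are disregarded. It is known (Dabrowski et al.) that $\pi'$ is a $*$-representation of $\mathcal{A}$ by bounded operators. **The operator $D$ on $\mathscr{H}$** is the diagonal self-adjoint operator $Du^n_{ij}=(2n+1)u^n_{ij}$, $Dd^n_{ij}=-2n\,d^n_{ij}$.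 *)

theory Defs
  imports "HOL-Analysis.Analysis"
begin

section \<open>Complex Banach spaces, Hilbert spaces and C*-algebras\<close>

text \<open>HOL-Analysis provides only real Banach spaces; the classes below add a compatible complex
  structure, so that norms, limits, closures etc. are those of the library.\<close>

class complex_banach = banach +
  fixes scaleC :: "complex \<Rightarrow> 'a \<Rightarrow> 'a" (infixr "*\<^sub>C" 75)
  assumes scaleC_add_right: "c *\<^sub>C (x + y) = c *\<^sub>C x + c *\<^sub>C y"
    and scaleC_add_left: "(c + d) *\<^sub>C x = c *\<^sub>C x + d *\<^sub>C x"
    and scaleC_scaleC: "c *\<^sub>C d *\<^sub>C x = (c * d) *\<^sub>C x"
    and scaleR_scaleC: "r *\<^sub>R x = complex_of_real r *\<^sub>C x"
    and norm_scaleC: "norm (c *\<^sub>C x) = cmod c * norm x"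

text \<open>Inner products are conjugate-linear in the first argument.\<close>

class complex_hilbert = complex_banach +
  fixes cinner :: "'a \<Rightarrow> 'a \<Rightarrow> complex"
  assumes cinner_commute: "cinner x y = cnj (cinner y x)"
    and cinner_add_right: "cinner x (y + z) = cinner x y + cinner x z"
    and cinner_scaleC_right: "cinner x (c *\<^sub>C y) = c * cinner x y"
    and cinner_self: "cinner x x = complex_of_real ((norm x)\<^sup>2)"

text \<open>Unital C*-algebras.\<close>

class cstar_algebra = complex_banach + real_normed_algebra_1 +
  fixes star :: "'a \<Rightarrow> 'a"
  assumes mult_scaleC_left: "(c *\<^sub>C x) * y = c *\<^sub>C (x * y)"
    and mult_scaleC_right: "x * (c *\<^sub>C y) = c *\<^sub>C (x * y)"
    and star_add: "star (x + y) = star x + star y"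
    and star_scaleC: "star (c *\<^sub>C x) = cnj c *\<^sub>C star x"
    and star_mult: "star (x * y) = star y * star x"
    and star_star: "star (star x) = x"
    and cstar_identity: "norm (star x * x) = (norm x)\<^sup>2"

text \<open>The product type with this structure is the Hilbert space direct sum.\<close>

instantiation prod :: (complex_banach, complex_banach) complex_banach
begin

definition scaleC_prod :: "complex \<Rightarrow> 'a \<times> 'b \<Rightarrow> 'a \<times> 'b"
  where "scaleC_prod c x = (c *\<^sub>C fst x, c *\<^sub>C snd x)"

instance
proof
  fix c d :: complex and r :: real and x y :: "'a \<times> 'b"
  show "c *\<^sub>C (x + y) = c *\<^sub>C x + c *\<^sub>C y" "(c + d) *\<^sub>C x = c *\<^sub>C x + d *\<^sub>C x"
    "c *\<^sub>C d *\<^sub>C x = (c * d) *\<^sub>C x" "r *\<^sub>R x = complex_of_real r *\<^sub>C x"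
    by (simp_all add: scaleC_prod_def scaleC_add_right scaleC_add_left scaleC_scaleC
        scaleR_scaleC prod_eq_iff)
  have "(norm (c *\<^sub>C x))\<^sup>2 = (cmod c * norm x)\<^sup>2"
    by (simp add: norm_prod_def scaleC_prod_def norm_scaleC power_mult_distrib distrib_left)
  then show "norm (c *\<^sub>C x) = cmod c * norm x"
    by simp
qed

end

instantiation prod :: (complex_hilbert, complex_hilbert) complex_hilbert
begin

definition cinner_prod :: "'a \<times> 'b \<Rightarrow> 'a \<times> 'b \<Rightarrow> complex"
  where "cinner_prod x y = cinner (fst x) (fst y) + cinner (snd x) (snd y)"

instance
proof
  fix c :: complex and x y z :: "'a \<times> 'b"
  show "cinner x y = cnj (cinner y x)"
    unfolding cinner_prod_def by (metis cinner_commute complex_cnj_add)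
  show "cinner x (y + z) = cinner x y + cinner x z" "cinner x (c *\<^sub>C y) = c * cinner x y"
    by (simp_all add: cinner_prod_def scaleC_prod_def cinner_add_right cinner_scaleC_right
        distrib_left)
  show "cinner x x = complex_of_real ((norm x)\<^sup>2)"
    by (simp add: cinner_prod_def norm_prod_def cinner_self)
qed

end

section \<open>Operators\<close>

definition bounded_clinear :: "('a::complex_banach \<Rightarrow> 'b::complex_banach) \<Rightarrow> bool"
  where "bounded_clinear T \<longleftrightarrow> bounded_linear T \<and> (\<forall>c x. T (c *\<^sub>C x) = c *\<^sub>C T x)"

definition adjoint_op :: "('a::complex_hilbert \<Rightarrow> 'b::complex_hilbert) \<Rightarrow> 'b \<Rightarrow> 'a"
  where "adjoint_op T = (THE S. \<forall>x y. cinner (T x) y = cinner x (S y))"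

definition unitary_op :: "('a::complex_hilbert \<Rightarrow> 'b::complex_hilbert) \<Rightarrow> bool"
  where "unitary_op U \<longleftrightarrow>
    bounded_clinear U \<and> adjoint_op U \<circ> U = id \<and> U \<circ> adjoint_op U = id"

text \<open>The two-sided ideal of the algebra of bounded operators generated by the bounded operator
  \<open>T\<close> (algebraically: no closure is taken). Closure under negation and scalars comes from
  multiplication by scalar operators.\<close>

inductive_set ideal_generated :: "('a::complex_hilbert \<Rightarrow> 'a) \<Rightarrow> ('a \<Rightarrow> 'a) set"
  for T :: "'a \<Rightarrow> 'a"
  where
    generator: "T \<in> ideal_generated T"
  | add: "R \<in> ideal_generated T \<Longrightarrow> S \<in> ideal_generated T
      \<Longrightarrow> (\<lambda>x. R x + S x) \<in> ideal_generated T"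
  | mult_left: "bounded_clinear B \<Longrightarrow> R \<in> ideal_generated T \<Longrightarrow> B \<circ> R \<in> ideal_generated T"
  | mult_right: "bounded_clinear B \<Longrightarrow> R \<in> ideal_generated T \<Longrightarrow> R \<circ> B \<in> ideal_generated T"

text \<open>An orthonormal basis is a maximal orthonormal family.\<close>

definition orthonormal_basis :: "'i set \<Rightarrow> ('i \<Rightarrow> 'a::complex_hilbert) \<Rightarrow> bool"
  where "orthonormal_basis I e \<longleftrightarrow>
    (\<forall>k\<in>I. \<forall>l\<in>I. cinner (e k) (e l) = (if k = l then 1 else 0)) \<and>
    (\<forall>x. (\<forall>k\<in>I. cinner (e k) x = 0) \<longrightarrow> x = 0)"

text \<open>The bounded operator sending the basis vector \<open>e k\<close> to \<open>w k\<close> times itself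
  (for bounded \<open>w\<close>).\<close>

definition bounded_diagonal ::
    "'i set \<Rightarrow> ('i \<Rightarrow> 'a::complex_hilbert) \<Rightarrow> ('i \<Rightarrow> real) \<Rightarrow> 'a \<Rightarrow> 'a"
  where "bounded_diagonal I e w =
    (THE T. bounded_clinear T \<and> (\<forall>k\<in>I. T (e k) = w k *\<^sub>R e k))"

text \<open>Unbounded operators are represented by their graphs; equality of graphs is equality of
  operators including their domains. With this encoding the relation product \<open>T O S\<close>
  is the operator product of \<open>S\<close> and \<open>T\<close>, in the order first \<open>T\<close>, then \<open>S\<close>,
  with its natural domain.\<close>

type_synonym ('a, 'b) op_graph = "('a \<times> 'b) set"

definition adjoint_graph ::
    "('a::complex_hilbert, 'b::complex_hilbert) op_graph \<Rightarrow> ('b, 'a) op_graph"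
  where "adjoint_graph T = {(y, z). \<forall>(x, w)\<in>T. cinner w y = cinner x z}"

definition self_adjoint_graph :: "('a::complex_hilbert, 'a) op_graph \<Rightarrow> bool"
  where "self_adjoint_graph T \<longleftrightarrow>
    single_valued T \<and> closure (Domain T) = UNIV \<and> adjoint_graph T = T"

definition positive_graph :: "('a::complex_hilbert, 'a) op_graph \<Rightarrow> bool"
  where "positive_graph T \<longleftrightarrow> (\<forall>(x, y)\<in>T. cinner x y \<in> \<real>\<^sub>\<ge>\<^sub>0)"

text \<open>\<open>|T|\<close> is the positive self-adjoint square root of \<open>T\<^sup>*T\<close>.\<close>

definition abs_graph :: "('a::complex_hilbert, 'a) op_graph \<Rightarrow> ('a, 'a) op_graph"
  where "abs_graph T =
    (THE S. self_adjoint_graph S \<and> positive_graph S \<and> S O S = T O adjoint_graph T)"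

definition direct_sum_graph ::
    "('a, 'a) op_graph \<Rightarrow> ('b, 'b) op_graph \<Rightarrow> ('a \<times> 'b, 'a \<times> 'b) op_graph"
  where "direct_sum_graph S T = {((x, y), (x', y')). (x, x') \<in> S \<and> (y, y') \<in> T}"

text \<open>The graph of \<open>U T U\<^sup>*\<close>.\<close>

definition conjugate_graph ::
    "('a::complex_hilbert \<Rightarrow> 'b::complex_hilbert) \<Rightarrow> ('a, 'a) op_graph \<Rightarrow> ('b, 'b) op_graph"
  where "conjugate_graph U T = {(y, U w) |y w. (adjoint_op U y, w) \<in> T}"

text \<open>The self-adjoint operator with \<open>e k\<close> an eigenvector for the eigenvalue \<open>w k\<close>: its domain
  consists of all \<open>x\<close> for which the family of the numbers \<open>w k * cinner (e k) x\<close> is square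
  summable, that is, is the family of coefficients of some vector \<open>y\<close>.\<close>

definition diagonal_graph ::
    "'i set \<Rightarrow> ('i \<Rightarrow> 'a::complex_hilbert) \<Rightarrow> ('i \<Rightarrow> real) \<Rightarrow> ('a, 'a) op_graph"
  where "diagonal_graph I e w =
    {(x, y). \<forall>k\<in>I. cinner (e k) y = complex_of_real (w k) * cinner (e k) x}"

section \<open>The algebra of continuous functions on quantum SU(2)\<close>

definition star_hom :: "('a::cstar_algebra \<Rightarrow> 'b::cstar_algebra) \<Rightarrow> bool"
  where "star_hom \<phi> \<longleftrightarrow>
    (\<forall>a b. \<phi> (a + b) = \<phi> a + \<phi> b) \<and> (\<forall>c a. \<phi> (c *\<^sub>C a) = c *\<^sub>C \<phi> a) \<and>
    (\<forall>a b. \<phi> (a * b) = \<phi> a * \<phi> b) \<and> \<phi> 1 = 1 \<and> (\<forall>a. \<phi> (star a) = star (\<phi> a))"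

definition star_representation ::
    "('a::cstar_algebra \<Rightarrow> 'h::complex_hilbert \<Rightarrow> 'h) \<Rightarrow> bool"
  where "star_representation \<rho> \<longleftrightarrow>
    (\<forall>a. bounded_clinear (\<rho> a)) \<and>
    (\<forall>a b x. \<rho> (a + b) x = \<rho> a x + \<rho> b x) \<and> (\<forall>c a x. \<rho> (c *\<^sub>C a) x = c *\<^sub>C \<rho> a x) \<and>
    (\<forall>a b. \<rho> (a * b) = \<rho> a \<circ> \<rho> b) \<and> \<rho> 1 = id \<and>
    (\<forall>a x y. cinner (\<rho> (star a) x) y = cinner x (\<rho> a y))"

inductive_set star_subalgebra :: "'a::cstar_algebra set \<Rightarrow> 'a set"
  for G :: "'a set"
  where
    generator: "a \<in> G \<Longrightarrow> a \<in> star_subalgebra G"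
  | zero: "0 \<in> star_subalgebra G"
  | add: "a \<in> star_subalgebra G \<Longrightarrow> b \<in> star_subalgebra G \<Longrightarrow> a + b \<in> star_subalgebra G"
  | scaleC: "a \<in> star_subalgebra G \<Longrightarrow> c *\<^sub>C a \<in> star_subalgebra G"
  | mult: "a \<in> star_subalgebra G \<Longrightarrow> b \<in> star_subalgebra G \<Longrightarrow> a * b \<in> star_subalgebra G"
  | star: "a \<in> star_subalgebra G \<Longrightarrow> star a \<in> star_subalgebra G"

definition SUq2_relations :: "real \<Rightarrow> 'a::cstar_algebra \<Rightarrow> 'a \<Rightarrow> bool"
  where "SUq2_relations q \<alpha> \<beta> \<longleftrightarrow>
    star \<alpha> * \<alpha> + star \<beta> * \<beta> = 1 \<and> \<alpha> * star \<alpha> + q\<^sup>2 *\<^sub>R (\<beta> * star \<beta>) = 1 \<and>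
    \<alpha> * \<beta> = q *\<^sub>R (\<beta> * \<alpha>) \<and> \<alpha> * star \<beta> = q *\<^sub>R (star \<beta> * \<alpha>) \<and>
    star \<beta> * \<beta> = \<beta> * star \<beta>"

text \<open>The ambient type \<open>'a\<close>, generated by \<open>\<alpha>\<close> and \<open>\<beta>\<close>, is the universal C*-algebra for the
  relations. HOL cannot quantify over types inside a formula, so the C*-algebras tested in the
  universal property are those on a type \<open>'b\<close>. A theorem assuming this predicate with a type
  variable \<open>'b\<close> holds for each choice of \<open>'b\<close>, in particular for the algebra that is universal
  for all of them.\<close>

definition universal_SUq2 :: "'b::cstar_algebra itself \<Rightarrow> real \<Rightarrow> 'a::cstar_algebra \<Rightarrow> 'a \<Rightarrow> bool"
  where "universal_SUq2 _ q \<alpha> \<beta> \<longleftrightarrow>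
    SUq2_relations q \<alpha> \<beta> \<and> closure (star_subalgebra {\<alpha>, \<beta>}) = UNIV \<and>
    (\<forall>x y :: 'b. SUq2_relations q x y \<longrightarrow> (\<exists>\<phi> :: 'a \<Rightarrow> 'b. star_hom \<phi> \<and> \<phi> \<alpha> = x \<and> \<phi> \<beta> = y))"

text \<open>The two labels index both the rows and columns of 2 by 2 matrices and the two families of
  basis vectors \<open>u\<close> (\<open>Up\<close>) and \<open>d\<close> (\<open>Down\<close>).\<close>

datatype spin = Up | Down

fun mat2 :: "'c \<Rightarrow> 'c \<Rightarrow> 'c \<Rightarrow> 'c \<Rightarrow> spin \<Rightarrow> spin \<Rightarrow> 'c"
  where
    "mat2 m11 m12 m21 m22 Up Up = m11"
  | "mat2 m11 m12 m21 m22 Up Down = m12"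
  | "mat2 m11 m12 m21 m22 Down Up = m21"
  | "mat2 m11 m12 m21 m22 Down Down = m22"

text \<open>The fundamental unitary corepresentation, and the entries of its tensor powers. The
  comultiplication maps \<open>corep_entry q \<alpha> \<beta> K L\<close> to the sum over \<open>M\<close> of the tensors of
  \<open>corep_entry q \<alpha> \<beta> K M\<close> with \<open>corep_entry q \<alpha> \<beta> M L\<close>; these entries span the
  *-algebra generated by \<open>\<alpha>\<close> and \<open>\<beta>\<close>.\<close>

definition fundamental_corep :: "real \<Rightarrow> 'a::cstar_algebra \<Rightarrow> 'a \<Rightarrow> spin \<Rightarrow> spin \<Rightarrow> 'a"
  where "fundamental_corep q \<alpha> \<beta> = mat2 \<alpha> (- (q *\<^sub>R star \<beta>)) \<beta> (star \<alpha>)"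

definition corep_entry :: "real \<Rightarrow> 'a::cstar_algebra \<Rightarrow> 'a \<Rightarrow> spin list \<Rightarrow> spin list \<Rightarrow> 'a"
  where "corep_entry q \<alpha> \<beta> K L = prod_list (map2 (fundamental_corep q \<alpha> \<beta>) K L)"

definition state :: "('a::cstar_algebra \<Rightarrow> complex) \<Rightarrow> bool"
  where "state h \<longleftrightarrow>
    (\<forall>a b. h (a + b) = h a + h b) \<and> (\<forall>c a. h (c *\<^sub>C a) = c * h a) \<and>
    (\<forall>a. h (star a * a) \<in> \<real>\<^sub>\<ge>\<^sub>0) \<and> h 1 = 1"

text \<open>The Haar state is the state \<open>h\<close> with
  \<open>(id \<otimes> h) \<Delta> a = h a 1 = (h \<otimes> id) \<Delta> a\<close>. By linearity and continuity it suffices to require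
  this for the entries \<open>a\<close> of the tensor powers, where \<open>\<Delta>\<close> is explicit.\<close>

definition haar_state :: "real \<Rightarrow> 'a::cstar_algebra \<Rightarrow> 'a \<Rightarrow> ('a \<Rightarrow> complex) \<Rightarrow> bool"
  where "haar_state q \<alpha> \<beta> h \<longleftrightarrow> state h \<and>
    (\<forall>K L. length K = length L \<longrightarrow>
      (\<Sum>M | length M = length K. h (corep_entry q \<alpha> \<beta> M L) *\<^sub>C corep_entry q \<alpha> \<beta> K M)
        = h (corep_entry q \<alpha> \<beta> K L) *\<^sub>C 1 \<and>
      (\<Sum>M | length M = length K. h (corep_entry q \<alpha> \<beta> K M) *\<^sub>C corep_entry q \<alpha> \<beta> M L)
        = h (corep_entry q \<alpha> \<beta> K L) *\<^sub>C 1)"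

definition gns_triple ::
    "('a::cstar_algebra \<Rightarrow> complex) \<Rightarrow> ('a \<Rightarrow> 'h::complex_hilbert \<Rightarrow> 'h) \<Rightarrow> 'h \<Rightarrow> bool"
  where "gns_triple h \<pi> \<Omega> \<longleftrightarrow> star_representation \<pi> \<and>
    (\<forall>a. h a = cinner \<Omega> (\<pi> a \<Omega>)) \<and> closure (range (\<lambda>a. \<pi> a \<Omega>)) = UNIV"

section \<open>The two bases and the explicit representations\<close>

text \<open>Labels in 0, 1/2, 1, \<dots> and weights are real numbers; \<open>weights l\<close> is the set of
  \<open>-l, -l + 1, \<dots>, l\<close> (empty for negative \<open>l\<close>).\<close>

definition half_naturals :: "real set"
  where "half_naturals = {real k / 2 |k. True}"

definition weights :: "real \<Rightarrow> real set"
  where "weights l = {- l + real k |k. real k \<le> 2 * l}"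

definition e_index :: "(real \<times> real \<times> real) set"
  where "e_index = {(n, i, j). n \<in> half_naturals \<and> i \<in> weights n \<and> j \<in> weights n}"

definition v_index :: "(spin \<times> real \<times> real \<times> real) set"
  where "v_index =
    {(Up, n, i, j) |n i j. n \<in> half_naturals \<and> i \<in> weights n \<and> j \<in> weights (n + 1/2)} \<union>
    {(Down, n, i, j) |n i j. n \<in> half_naturals \<and> 0 < n \<and> i \<in> weights n \<and> j \<in> weights (n - 1/2)}"

definition a_plus :: "real \<Rightarrow> real \<Rightarrow> real \<Rightarrow> real \<Rightarrow> real"
  where "a_plus q n i j = sqrt (q powr (2 * (n + i) + 2 * (n + j) + 2) *
    ((1 - q powr (2 * n - 2 * j + 2)) * (1 - q powr (2 * n - 2 * i + 2)) /
     ((1 - q powr (4 * n + 2)) * (1 - q powr (4 * n + 4)))))"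

definition a_minus :: "real \<Rightarrow> real \<Rightarrow> real \<Rightarrow> real \<Rightarrow> real"
  where "a_minus q n i j = (if n = 0 then 0 else
    sqrt ((1 - q powr (2 * n + 2 * j)) * (1 - q powr (2 * n + 2 * i)) /
     ((1 - q powr (4 * n)) * (1 - q powr (4 * n + 2)))))"

definition b_plus :: "real \<Rightarrow> real \<Rightarrow> real \<Rightarrow> real \<Rightarrow> real"
  where "b_plus q n i j = - sqrt (q powr (2 * (n + j)) *
    ((1 - q powr (2 * n - 2 * j + 2)) * (1 - q powr (2 * n + 2 * i + 2)) /
     ((1 - q powr (4 * n + 2)) * (1 - q powr (4 * n + 4)))))"

definition b_minus :: "real \<Rightarrow> real \<Rightarrow> real \<Rightarrow> real \<Rightarrow> real"
  where "b_minus q n i j = (if n = 0 then 0 else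
    sqrt (q powr (2 * (n + i)) *
     ((1 - q powr (2 * n + 2 * j)) * (1 - q powr (2 * n - 2 * i)) /
      ((1 - q powr (4 * n)) * (1 - q powr (4 * n + 2))))))"

text \<open>The standard basis of the GNS space. The components of \<open>\<pi> \<alpha> (e (n, i, j))\<close> and
  \<open>\<pi> \<beta> (e (n, i, j))\<close> with index outside \<open>e_index\<close> have coefficient 0. Since \<open>a_plus\<close> and
  \<open>b_plus\<close> do not vanish on \<open>e_index\<close>, these conditions determine \<open>e\<close> from \<open>\<pi>\<close> and \<open>\<Omega>\<close>.\<close>

definition standard_basis ::
    "real \<Rightarrow> 'a \<Rightarrow> 'a \<Rightarrow> ('a::cstar_algebra \<Rightarrow> 'h::complex_hilbert \<Rightarrow> 'h) \<Rightarrow> 'h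
      \<Rightarrow> (real \<times> real \<times> real \<Rightarrow> 'h) \<Rightarrow> bool"
  where "standard_basis q \<alpha> \<beta> \<pi> \<Omega> e \<longleftrightarrow>
    orthonormal_basis e_index e \<and> e (0, 0, 0) = \<Omega> \<and>
    (\<forall>(n, i, j)\<in>e_index.
      \<pi> \<alpha> (e (n, i, j)) = a_plus q n i j *\<^sub>R e (n + 1/2, i - 1/2, j - 1/2)
                        + a_minus q n i j *\<^sub>R e (n - 1/2, i - 1/2, j - 1/2) \<and>
      \<pi> \<beta> (e (n, i, j)) = b_plus q n i j *\<^sub>R e (n + 1/2, i + 1/2, j - 1/2)
                        + b_minus q n i j *\<^sub>R e (n - 1/2, i + 1/2, j - 1/2))"

definition D1_eigenvalue :: "real \<times> real \<times> real \<Rightarrow> real"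
  where "D1_eigenvalue = (\<lambda>(n, i, j). if j \<noteq> n then - 2 * n else 2 * n + 1)"

definition D2_eigenvalue :: "real \<times> real \<times> real \<Rightarrow> real"
  where "D2_eigenvalue = (\<lambda>(n, i, j). if j \<noteq> n then - 2 * n - 1 else 2 * n + 1)"

fun D_eigenvalue :: "spin \<times> real \<times> real \<times> real \<Rightarrow> real"
  where
    "D_eigenvalue (Up, n, i, j) = 2 * n + 1"
  | "D_eigenvalue (Down, n, i, j) = - 2 * n"

definition q_number :: "real \<Rightarrow> real \<Rightarrow> real"
  where "q_number q m = (q powr m - q powr (- m)) / (q - inverse q)"

text \<open>The matrices \<open>a\<^sup>\<plusminus>\<close> and \<open>b\<^sup>\<plusminus>\<close> (row index first). Matrix entries belonging to
  nonexistent basis vectors take arbitrary values here and are never used.\<close>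

definition mat_a_plus :: "real \<Rightarrow> real \<Rightarrow> real \<Rightarrow> real \<Rightarrow> spin \<Rightarrow> spin \<Rightarrow> real"
  where "mat_a_plus q n i j t s =
    q powr ((i + j - 1/2) / 2) * sqrt (q_number q (n + i + 1)) *
    mat2
      (q powr (- n - 1/2) * (sqrt (q_number q (n + j + 3/2)) / q_number q (2 * n + 2)))
      0
      (q powr (1/2) *
        (sqrt (q_number q (n - j + 1/2)) / (q_number q (2 * n + 1) * q_number q (2 * n + 2))))
      (q powr (- n) * (sqrt (q_number q (n + j + 1/2)) / q_number q (2 * n + 1)))
      t s"

definition mat_a_minus :: "real \<Rightarrow> real \<Rightarrow> real \<Rightarrow> real \<Rightarrow> spin \<Rightarrow> spin \<Rightarrow> real"
  where "mat_a_minus q n i j t s =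
    q powr ((i + j - 1/2) / 2) * sqrt (q_number q (n - i)) *
    mat2
      (q powr (n + 1) * (sqrt (q_number q (n - j + 1/2)) / q_number q (2 * n + 1)))
      (- (q powr (1/2)) *
        (sqrt (q_number q (n + j + 1/2)) / (q_number q (2 * n) * q_number q (2 * n + 1))))
      0
      (q powr (n + 1/2) * (sqrt (q_number q (n - j - 1/2)) / q_number q (2 * n)))
      t s"

definition mat_b_plus :: "real \<Rightarrow> real \<Rightarrow> real \<Rightarrow> real \<Rightarrow> spin \<Rightarrow> spin \<Rightarrow> real"
  where "mat_b_plus q n i j t s =
    q powr ((i + j - 1/2) / 2) * sqrt (q_number q (n + i + 1)) *
    mat2
      (sqrt (q_number q (n - j + 3/2)) / q_number q (2 * n + 2))
      0
      (- (q powr (- n - 1)) *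
        (sqrt (q_number q (n + j + 1/2)) / (q_number q (2 * n + 1) * q_number q (2 * n + 2))))
      (q powr (- 1/2) * (sqrt (q_number q (n - j + 1/2)) / q_number q (2 * n + 1)))
      t s"

definition mat_b_minus :: "real \<Rightarrow> real \<Rightarrow> real \<Rightarrow> real \<Rightarrow> spin \<Rightarrow> spin \<Rightarrow> real"
  where "mat_b_minus q n i j t s =
    q powr ((i + j - 1/2) / 2) * sqrt (q_number q (n - i)) *
    mat2
      (- (q powr (- 1/2)) * (sqrt (q_number q (n + j + 1/2)) / q_number q (2 * n + 1)))
      (- (q powr n) *
        (sqrt (q_number q (n - j + 1/2)) / (q_number q (2 * n) * q_number q (2 * n + 1))))
      0
      (- (sqrt (q_number q (n + j - 1/2)) / q_number q (2 * n)))
      t s"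

text \<open>The matrices with tilde are hermitian conjugates of real matrices, that is, transposes.\<close>

definition mat_a_plus' :: "real \<Rightarrow> real \<Rightarrow> real \<Rightarrow> real \<Rightarrow> spin \<Rightarrow> spin \<Rightarrow> real"
  where "mat_a_plus' q n i j t s = mat_a_minus q (n + 1/2) (i - 1/2) (j - 1/2) s t"

definition mat_a_minus' :: "real \<Rightarrow> real \<Rightarrow> real \<Rightarrow> real \<Rightarrow> spin \<Rightarrow> spin \<Rightarrow> real"
  where "mat_a_minus' q n i j t s = mat_a_plus q (n - 1/2) (i - 1/2) (j - 1/2) s t"

definition mat_b_plus' :: "real \<Rightarrow> real \<Rightarrow> real \<Rightarrow> real \<Rightarrow> spin \<Rightarrow> spin \<Rightarrow> real"
  where "mat_b_plus' q n i j t s = mat_b_minus q (n + 1/2) (i - 1/2) (j + 1/2) s t"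

definition mat_b_minus' :: "real \<Rightarrow> real \<Rightarrow> real \<Rightarrow> real \<Rightarrow> spin \<Rightarrow> spin \<Rightarrow> real"
  where "mat_b_minus' q n i j t s = mat_b_plus q (n - 1/2) (i - 1/2) (j + 1/2) s t"

text \<open>Column \<open>s\<close> of the matrix \<open>m\<close> applied to the pair of basis vectors at \<open>(n, i, j)\<close>.\<close>

definition column ::
    "(spin \<times> real \<times> real \<times> real \<Rightarrow> 'h::complex_hilbert) \<Rightarrow> (spin \<Rightarrow> spin \<Rightarrow> real)
      \<Rightarrow> spin \<Rightarrow> real \<Rightarrow> real \<Rightarrow> real \<Rightarrow> 'h"
  where "column v m s n i j = m Up s *\<^sub>R v (Up, n, i, j) + m Down s *\<^sub>R v (Down, n, i, j)"

text \<open>The space of spinors: \<open>v (Up, n, i, j)\<close> is \<open>u\<^sup>n\<^sub>i\<^sub>j\<close> and \<open>v (Down, n, i, j)\<close> is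
  \<open>d\<^sup>n\<^sub>i\<^sub>j\<close>, with vectors whose indices are out of range equal to 0.\<close>

definition spinor_basis :: "(spin \<times> real \<times> real \<times> real \<Rightarrow> 'h::complex_hilbert) \<Rightarrow> bool"
  where "spinor_basis v \<longleftrightarrow> orthonormal_basis v_index v \<and> (\<forall>k. k \<notin> v_index \<longrightarrow> v k = 0)"

definition spinor_representation ::
    "real \<Rightarrow> 'a \<Rightarrow> 'a \<Rightarrow> (spin \<times> real \<times> real \<times> real \<Rightarrow> 'h)
      \<Rightarrow> ('a::cstar_algebra \<Rightarrow> 'h::complex_hilbert \<Rightarrow> 'h) \<Rightarrow> bool"
  where "spinor_representation q \<alpha> \<beta> v \<pi>' \<longleftrightarrow> star_representation \<pi>' \<and>
    (\<forall>(s, n, i, j)\<in>v_index.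
      \<pi>' (star \<alpha>) (v (s, n, i, j)) =
          column v (mat_a_plus q n i j) s (n + 1/2) (i + 1/2) (j + 1/2)
        + column v (mat_a_minus q n i j) s (n - 1/2) (i + 1/2) (j + 1/2) \<and>
      \<pi>' (- \<beta>) (v (s, n, i, j)) =
          column v (mat_b_plus q n i j) s (n + 1/2) (i + 1/2) (j - 1/2)
        + column v (mat_b_minus q n i j) s (n - 1/2) (i + 1/2) (j - 1/2) \<and>
      \<pi>' \<alpha> (v (s, n, i, j)) =
          column v (mat_a_plus' q n i j) s (n + 1/2) (i - 1/2) (j - 1/2)
        + column v (mat_a_minus' q n i j) s (n - 1/2) (i - 1/2) (j - 1/2) \<and>
      \<pi>' (- star \<beta>) (v (s, n, i, j)) =
          column v (mat_b_plus' q n i j) s (n + 1/2) (i - 1/2) (j + 1/2)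
        + column v (mat_b_minus' q n i j) s (n - 1/2) (i - 1/2) (j + 1/2))"

definition ideal_Kq ::
    "real \<Rightarrow> (spin \<times> real \<times> real \<times> real \<Rightarrow> 'h::complex_hilbert) \<Rightarrow> ('h \<Rightarrow> 'h) set"
  where "ideal_Kq q v =
    ideal_generated (bounded_diagonal v_index v (\<lambda>(s, n, i, j). q powr n))"

end

theory Submission
  imports Defs
begin

text \<open>The unitary \<open>U\<close> maps \<open>(e (n, i, n), 0)\<close> to \<open>u\<^sup>n\<^sub>i\<^sub>j\<close> with \<open>j = n + 1/2\<close>,
  \<open>(e (n, i, j), 0)\<close> with \<open>j \<noteq> n\<close> to \<open>d\<close> with labels \<open>n, i, j + 1/2\<close>, and \<open>(0, e (n, i, j))\<close> to
  \<open>u\<close> with labels \<open>n, i, j - 1/2\<close>. It matches the eigenvalues of \<open>D\<^sub>1 \<oplus> |D\<^sub>2|\<close> with those of \<open>D\<close>.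
  In the bases, \<open>U (\<pi> a \<oplus> \<pi> a) U\<^sup>* - \<pi>' a\<close> for \<open>a = \<alpha>, \<beta>\<close> is a finite sum of weighted shifts
  whose weights at level \<open>n\<close> are \<open>O(q\<^sup>n)\<close>: the diagonal entries of the matrices of \<open>\<pi>'\<close> have the
  same leading terms as the coefficients of \<open>\<pi>\<close>, and the off-diagonal ones are negligible. Such a sum
  factors through the generator of the ideal, and so does its adjoint; this covers \<open>\<alpha>\<^sup>*\<close> and
  \<open>\<beta>\<^sup>*\<close>. Products follow from \<open>A B - A' B' = (A - A') B + A' (B - B')\<close>.\<close>

section \<open>Orthonormal bases and weighted shifts\<close>

text \<open>The labels match because of multiplicities. Level n of one copy of L_2(h) has (2n+1)^2
  vectors, while D has the eigenvalue 2n+1 with multiplicity (2n+1)(2n+2) and -2n with multiplicity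
  (2n+1)2n. Hence the 2n+1 vectors with j = n of the first copy join the whole second copy. The
  ideal is algebraic, so compactness of the difference would not suffice: one constant times q^n
  must bound its entries uniformly in i and j. Uniformity is the obstacle, since a factor like 1 -
  q^(2(n-j)) stays away from 1 for j near n. What helps is that corresponding diagonal entries away
  from the edge j = n + 1/2 share their power q^p and the factor depending on i. The factor
  depending on j either agrees or has its argument shifted by 1, and then p plus either argument is
  at least n, so q^p supplies the decay that this factor lacks. The denominators depend on n only
  and tend to 1 fast enough. At the edge, lowering entries compare in the same way, with a shift by
  1, whereas each raising entry is small by its own power of q.\<close>

lemma scaleC_zero_right [simp]: "c *\<^sub>C (0::'a::complex_banach) = 0"
  using scaleC_add_right[of c 0 "0::'a"] by simp

lemma scaleC_zero_left [simp]: "0 *\<^sub>C (x::'a::complex_banach) = 0"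
  using scaleC_add_left[of 0 0 x] by simp

lemma scaleC_scaleR_commute: "c *\<^sub>C r *\<^sub>R x = r *\<^sub>R c *\<^sub>C (x::'a::complex_banach)"
  by (simp add: scaleR_scaleC scaleC_scaleC mult.commute)

lemma scaleC_minus_right: "c *\<^sub>C (- x) = - (c *\<^sub>C (x::'a::complex_banach))"
  using scaleC_add_right[of c x "- x"] by (simp add: eq_neg_iff_add_eq_0 add.commute)

lemma scaleC_diff_right: "c *\<^sub>C (x - y) = c *\<^sub>C x - c *\<^sub>C (y::'a::complex_banach)"
  using scaleC_add_right[of c x "- y"] by (simp add: scaleC_minus_right)

section \<open>Inner product calculus up to the Cauchy-Schwarz inequality\<close>

lemma cinner_add_left: "cinner (x + y) z = cinner x z + cinner y (z::'a::complex_hilbert)"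
  by (metis cinner_add_right cinner_commute complex_cnj_add)

lemma cinner_scaleC_left: "cinner (c *\<^sub>C x) y = cnj c * cinner x (y::'a::complex_hilbert)"
  by (metis cinner_scaleC_right cinner_commute complex_cnj_mult)

lemma cinner_scaleR_left: "cinner (r *\<^sub>R x) y = of_real r * cinner x (y::'a::complex_hilbert)"
  by (simp add: scaleR_scaleC cinner_scaleC_left)

lemma cinner_scaleR_right: "cinner x (r *\<^sub>R y) = of_real r * cinner x (y::'a::complex_hilbert)"
  by (simp add: scaleR_scaleC cinner_scaleC_right)

lemma cinner_zero_right [simp]: "cinner x (0::'a::complex_hilbert) = 0"
  using cinner_add_right[of x 0 "0::'a"] by simp

lemma cinner_zero_left [simp]: "cinner 0 (x::'a::complex_hilbert) = 0"
  using cinner_add_left[of 0 "0::'a"] by simp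

lemma cinner_minus_right: "cinner x (- y) = - cinner x (y::'a::complex_hilbert)"
  using cinner_add_right[of x y "- y"] by (simp add: eq_neg_iff_add_eq_0 add.commute)

lemma cinner_diff_right: "cinner x (y - z) = cinner x y - cinner x (z::'a::complex_hilbert)"
  using cinner_add_right[of x y "- z"] by (simp add: cinner_minus_right)

lemma cinner_diff_left: "cinner (x - y) z = cinner x z - cinner y (z::'a::complex_hilbert)"
  by (metis cinner_diff_right cinner_commute complex_cnj_diff)

lemma cinner_sum_left: "cinner (sum f A) y = (\<Sum>k\<in>A. cinner (f k) (y::'a::complex_hilbert))"
  by (induction A rule: infinite_finite_induct) (simp_all add: cinner_add_left)

lemma cinner_sum_right: "cinner x (sum f A) = (\<Sum>k\<in>A. cinner x (f k :: 'a::complex_hilbert))"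
  by (induction A rule: infinite_finite_induct) (simp_all add: cinner_add_right)

lemma norm_diff_squared:
  "(norm (x - y))\<^sup>2 = (norm x)\<^sup>2 + (norm y)\<^sup>2 - 2 * Re (cinner x (y::'a::complex_hilbert))"
proof -
  have "complex_of_real ((norm (x - y))\<^sup>2) =
      of_real ((norm x)\<^sup>2) + of_real ((norm y)\<^sup>2) - (cinner x y + cnj (cinner x y))"
    unfolding cinner_self[symmetric] cinner_commute[of y x, symmetric]
    by (simp add: cinner_diff_left cinner_diff_right)
  then have "Re (complex_of_real ((norm (x - y))\<^sup>2)) =
      Re (of_real ((norm x)\<^sup>2) + of_real ((norm y)\<^sup>2) - (cinner x y + cnj (cinner x y)))"
    by simp
  then show ?thesis by simp
qed

text \<open>Subtracting from y its projection \<open>c *\<^sub>C x\<close> onto the line of x leaves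
  a vector of nonnegative squared norm; expanding that square is the inequality.\<close>

lemma norm_cinner_le: "cmod (cinner x y) \<le> norm x * norm (y::'a::complex_hilbert)"
proof (cases "x = 0")
  case False
  define c where "c = cinner x y / of_real ((norm x)\<^sup>2)"
  have cc: "cnj c * cinner x y = of_real ((cmod (cinner x y))\<^sup>2 / (norm x)\<^sup>2)"
    using complex_norm_square[of "cinner x y"] by (simp add: c_def mult.commute)
  have "Re (cinner y (c *\<^sub>C x)) = Re (cnj (cinner y (c *\<^sub>C x)))" by simp
  also have "\<dots> = Re (cnj c * cinner x y)"
    by (metis cinner_commute cinner_scaleC_left)
  finally have 1: "Re (cinner y (c *\<^sub>C x)) = (cmod (cinner x y))\<^sup>2 / (norm x)\<^sup>2"
    unfolding cc by simp
  have "cmod c = cmod (cinner x y) / (norm x)\<^sup>2"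
    by (simp add: c_def norm_divide norm_power)
  then have 2: "(norm (c *\<^sub>C x))\<^sup>2 = (cmod (cinner x y))\<^sup>2 / (norm x)\<^sup>2"
    using False by (simp add: norm_scaleC field_simps power2_eq_square)
  have "0 \<le> (norm (y - c *\<^sub>C x))\<^sup>2" by simp
  then have "(cmod (cinner x y))\<^sup>2 / (norm x)\<^sup>2 \<le> (norm y)\<^sup>2"
    unfolding norm_diff_squared 1 2 by simp
  then have "(cmod (cinner x y))\<^sup>2 \<le> (norm x * norm y)\<^sup>2"
    using False by (simp add: divide_le_eq power_mult_distrib mult.commute)
  then show ?thesis by (simp add: power2_le_iff_abs_le)
qed simp

lemma bounded_linear_cinner: "bounded_linear (\<lambda>y::'a::complex_hilbert. cinner x y)"
  by (rule bounded_linear_intro[of _ "norm x"])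
    (simp_all add: cinner_add_right cinner_scaleR_right scaleR_conv_of_real norm_cinner_le
      mult.commute[of "norm _" "norm x"])

lemma cinner_eqI:
  assumes "\<And>z. cinner z x = cinner z (y::'a::complex_hilbert)"
  shows "x = y"
proof -
  have "cinner (x - y) (x - y) = 0" using assms by (simp add: cinner_diff_right)
  then show ?thesis by (simp add: cinner_self)
qed

lemma bounded_clinear_scaleC: "bounded_clinear (\<lambda>x::'a::complex_banach. c *\<^sub>C x)"
  unfolding bounded_clinear_def
  by (auto intro!: bounded_linear_intro[of _ "cmod c"]
      simp: scaleC_add_right norm_scaleC mult.commute scaleC_scaleC scaleC_scaleR_commute)

lemma bounded_clinear_compose:
  "bounded_clinear S \<Longrightarrow> bounded_clinear T \<Longrightarrow> bounded_clinear (S \<circ> T)"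
  unfolding bounded_clinear_def comp_def by (simp add: bounded_linear_compose)

lemma bounded_clinear_diff:
  "bounded_clinear S \<Longrightarrow> bounded_clinear T \<Longrightarrow> bounded_clinear (\<lambda>x. S x - T x)"
  unfolding bounded_clinear_def by (simp add: bounded_linear_sub scaleC_diff_right)

lemma bounded_clinear_sum:
  "(\<And>m. m \<in> M \<Longrightarrow> bounded_clinear (T m)) \<Longrightarrow> bounded_clinear (\<lambda>x. \<Sum>m\<in>M. T m x)"
  by (induction M rule: infinite_finite_induct)
    (auto simp: bounded_clinear_def bounded_linear_zero bounded_linear_add scaleC_add_right)

section \<open>Orthonormal families: Bessel, Riesz-Fischer, Parseval\<close>

definition orthonormal_family :: "'i set \<Rightarrow> ('i \<Rightarrow> 'a::complex_hilbert) \<Rightarrow> bool"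
  where "orthonormal_family I e \<longleftrightarrow>
    (\<forall>k\<in>I. \<forall>l\<in>I. cinner (e k) (e l) = (if k = l then 1 else 0))"

lemma orthonormal_basis_family: "orthonormal_basis I e \<Longrightarrow> orthonormal_family I e"
  by (simp add: orthonormal_basis_def orthonormal_family_def)

lemma orthonormal_basis_eqI:
  assumes "orthonormal_basis I e" "\<And>k. k \<in> I \<Longrightarrow> cinner (e k) x = cinner (e k) y"
  shows "x = y"
proof -
  have "\<forall>k\<in>I. cinner (e k) (x - y) = 0"
    using assms(2) by (simp add: cinner_diff_right)
  then have "x - y = 0" using assms(1) unfolding orthonormal_basis_def by blast
  then show ?thesis by simp
qed

lemma orthonormal_family_subset:
  "orthonormal_family I e \<Longrightarrow> A \<subseteq> I \<Longrightarrow> orthonormal_family A e"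
  by (simp add: orthonormal_family_def subset_eq)

lemma norm_sum_orthonormal:
  assumes "orthonormal_family I e" "finite F" "F \<subseteq> I"
  shows "(norm (\<Sum>k\<in>F. a k *\<^sub>C e k))\<^sup>2 = (\<Sum>k\<in>F. (cmod (a k))\<^sup>2)"
proof -
  have "cinner (e k) (\<Sum>l\<in>F. a l *\<^sub>C e l) = a k" if "k \<in> F" for k
  proof -
    have "cinner (e k) (\<Sum>l\<in>F. a l *\<^sub>C e l) = (\<Sum>l\<in>F. if k = l then a l else 0)"
      unfolding cinner_sum_right
      using assms that
      by (intro sum.cong) (auto simp: orthonormal_family_def cinner_scaleC_right subset_iff)
    then show ?thesis using that assms by simp
  qed
  then have "complex_of_real ((norm (\<Sum>k\<in>F. a k *\<^sub>C e k))\<^sup>2) = (\<Sum>k\<in>F. cnj (a k) * a k)"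
    unfolding cinner_self[symmetric] by (subst cinner_sum_left) (simp add: cinner_scaleC_left)
  also have "\<dots> = complex_of_real (\<Sum>k\<in>F. (cmod (a k))\<^sup>2)"
    by (simp add: complex_norm_square mult.commute del: of_real_power)
  finally show ?thesis using of_real_eq_iff by blast
qed

text \<open>For the projection s of x onto the span, both \<open>cinner s x\<close> and the squared
  norm of s equal the sum on the left, so what is missing to the squared norm of x is that of s -
  x.\<close>

lemma bessel_finite:
  assumes "orthonormal_family I e" "finite F" "F \<subseteq> I"
  shows "(\<Sum>k\<in>F. (cmod (cinner (e k) x))\<^sup>2) \<le> (norm x)\<^sup>2"
proof -
  let ?s = "\<Sum>k\<in>F. cinner (e k) x *\<^sub>C e k"
  have "cinner ?s x = (\<Sum>k\<in>F. cnj (cinner (e k) x) * cinner (e k) x)"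
    by (simp add: cinner_sum_left cinner_scaleC_left)
  also have "\<dots> = of_real (\<Sum>k\<in>F. (cmod (cinner (e k) x))\<^sup>2)"
    by (simp add: complex_norm_square mult.commute del: of_real_power)
  finally have "Re (cinner ?s x) = (\<Sum>k\<in>F. (cmod (cinner (e k) x))\<^sup>2)" by simp
  then have "(norm (?s - x))\<^sup>2 = (norm x)\<^sup>2 - (\<Sum>k\<in>F. (cmod (cinner (e k) x))\<^sup>2)"
    unfolding norm_diff_squared norm_sum_orthonormal[OF assms] by simp
  moreover have "0 \<le> (norm (?s - x))\<^sup>2" by simp
  ultimately show ?thesis by linarith
qed

lemma bessel_summable:
  assumes "orthonormal_family I e"
  shows "(\<lambda>k. (cmod (cinner (e k) x))\<^sup>2) summable_on I"
    and "(\<Sum>\<^sub>\<infinity>k\<in>I. (cmod (cinner (e k) x))\<^sup>2) \<le> (norm x)\<^sup>2"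
proof -
  show 1: "(\<lambda>k. (cmod (cinner (e k) x))\<^sup>2) summable_on I"
    by (rule nonneg_bdd_above_summable_on)
      (auto intro!: bdd_aboveI[of _ "(norm x)\<^sup>2"] bessel_finite[OF assms])
  show "(\<Sum>\<^sub>\<infinity>k\<in>I. (cmod (cinner (e k) x))\<^sup>2) \<le> (norm x)\<^sup>2"
    using 1 by (rule infsum_le_finite_sums) (auto intro!: bessel_finite[OF assms])
qed

text \<open>By Pythagoras the part of the vector sum outside a finite set has as squared norm the
  corresponding part of the numerical series. The net of finite sums is therefore Cauchy, and
  completeness supplies the limit.\<close>

lemma riesz_fischer:
  fixes e :: "'i \<Rightarrow> 'a::complex_hilbert"
  assumes e: "orthonormal_family I e" and a: "(\<lambda>k. (cmod (a k))\<^sup>2) summable_on I"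
  shows "(\<lambda>k. a k *\<^sub>C e k) summable_on I"
proof -
  let ?f = "\<lambda>k. a k *\<^sub>C e k" and ?g = "\<lambda>k. (cmod (a k))\<^sup>2"
  have "\<exists>P. eventually P (finite_subsets_at_top I) \<and>
          (\<forall>F F'. P F \<and> P F' \<longrightarrow> dist (sum ?f F) (sum ?f F') < d)" if "d > 0" for d
  proof -
    \<comment> \<open>Two sums within d/3 of the sum over \<open>F0\<close> are at distance at most
      2d/3, which restores the strict inequality.\<close>
    have d: "0 < (d/3)\<^sup>2" using that by simp
    obtain F0 where F0: "finite F0" "F0 \<subseteq> I" "dist (sum ?g F0) (infsum ?g I) \<le> (d/3)\<^sup>2"
      using infsum_finite_approximation[OF a d] by blast
    have near: "dist (sum ?f F) (sum ?f F0) \<le> d/3" if F: "finite F" "F0 \<subseteq> F" "F \<subseteq> I" for F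
    proof -
      have "(dist (sum ?f F) (sum ?f F0))\<^sup>2 = (norm (sum ?f (F - F0)))\<^sup>2"
        unfolding dist_norm using F F0 by (simp add: sum_diff)
      also have "\<dots> = sum ?g (F - F0)"
        using F by (intro norm_sum_orthonormal[OF e]) auto
      also have "\<dots> = sum ?g F - sum ?g F0" using F by (simp add: sum_diff)
      also have "\<dots> \<le> infsum ?g I - sum ?g F0"
        using finite_sum_le_infsum[OF a, of F] F by simp
      also have "\<dots> \<le> (d/3)\<^sup>2" using F0(3) by (simp add: dist_real_def)
      finally show ?thesis using \<open>d > 0\<close> by (simp add: power2_le_iff_abs_le)
    qed
    have "dist (sum ?f F) (sum ?f F') < d"
      if "finite F" "F0 \<subseteq> F" "F \<subseteq> I" "finite F'" "F0 \<subseteq> F'" "F' \<subseteq> I" for F F'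
      using near[OF that(1-3)] near[OF that(4-6)] \<open>d > 0\<close>
        dist_triangle2[of "sum ?f F" "sum ?f F'" "sum ?f F0"] by simp
    moreover have "eventually (\<lambda>F. finite F \<and> F0 \<subseteq> F \<and> F \<subseteq> I) (finite_subsets_at_top I)"
      using F0 by (auto simp: eventually_finite_subsets_at_top)
    ultimately show ?thesis by (intro exI[of _ "\<lambda>F. finite F \<and> F0 \<subseteq> F \<and> F \<subseteq> I"]) auto
  qed
  then have "cauchy_filter (filtermap (sum ?f) (finite_subsets_at_top I))"
    by (simp add: cauchy_filter_metric_filtermap)
  moreover have "complete (UNIV::'a set)"
    by (meson Cauchy_convergent UNIV_I complete_def convergent_def)
  ultimately obtain L where "(sum ?f \<longlongrightarrow> L) (finite_subsets_at_top I)"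
    using complete_uniform[where S=UNIV] by (force simp add: filterlim_def)
  then show ?thesis using summable_on_def has_sum_def by blast
qed

lemma has_sum_cinner:
  "(f has_sum x) I \<Longrightarrow> ((\<lambda>k. cinner y (f k)) has_sum cinner y (x::'a::complex_hilbert)) I"
  using has_sum_bounded_linear[OF bounded_linear_cinner] .

lemma cinner_infsum_orthonormal:
  assumes e: "orthonormal_family I e" and a: "(\<lambda>k. (cmod (a k))\<^sup>2) summable_on I" and l: "l \<in> I"
  shows "cinner (e l) (\<Sum>\<^sub>\<infinity>k\<in>I. a k *\<^sub>C e k) = a l"
proof -
  have "((\<lambda>k. cinner (e l) (a k *\<^sub>C e k)) has_sum cinner (e l) (\<Sum>\<^sub>\<infinity>k\<in>I. a k *\<^sub>C e k)) I"
    by (intro has_sum_cinner has_sum_infsum riesz_fischer e a)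
  moreover have "((\<lambda>k. cinner (e l) (a k *\<^sub>C e k)) has_sum a l) I"
    using e l by (intro has_sum_finite_neutralI[of "{l}"])
      (auto simp: orthonormal_family_def cinner_scaleC_right)
  ultimately show ?thesis by (rule has_sum_unique)
qed

text \<open>Here maximality becomes totality: the series converges to a vector with the same
  coefficients as x, and only 0 is orthogonal to the whole family.\<close>

lemma orthonormal_expansion:
  assumes e: "orthonormal_basis I e"
  shows "((\<lambda>k. cinner (e k) x *\<^sub>C e k) has_sum x) I"
proof -
  note f = orthonormal_basis_family[OF e]
  have "(\<Sum>\<^sub>\<infinity>k\<in>I. cinner (e k) x *\<^sub>C e k) = x"
    by (rule orthonormal_basis_eqI[OF e])
      (simp add: cinner_infsum_orthonormal[OF f bessel_summable(1)[OF f]])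
  then show ?thesis
    using has_sum_infsum[OF riesz_fischer[OF f bessel_summable(1)[OF f, of x]]] by simp
qed

lemma parseval:
  assumes e: "orthonormal_basis I e"
  shows "((\<lambda>k. cinner x (e k) * cinner (e k) y) has_sum cinner x y) I"
  using has_sum_cinner[OF orthonormal_expansion[OF e, of y], of x]
  by (simp add: cinner_scaleC_right mult.commute)

lemma bounded_clinear_ext:
  assumes e: "orthonormal_basis I e" and S: "bounded_clinear S" and T: "bounded_clinear T"
    and eq: "\<And>k. k \<in> I \<Longrightarrow> S (e k) = T (e k)"
  shows "S = T"
proof
  fix x
  have *: "((\<lambda>k. cinner (e k) x *\<^sub>C R (e k)) has_sum R x) I"
    if R: "bounded_clinear R" for R :: "'b \<Rightarrow> 'c"
    using has_sum_bounded_linear[OF _ orthonormal_expansion[OF e, of x], of R] R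
    by (simp add: bounded_clinear_def)
  have "((\<lambda>k. cinner (e k) x *\<^sub>C S (e k)) has_sum T x) I"
    using *[OF T] by (subst has_sum_cong[of I _ "\<lambda>k. cinner (e k) x *\<^sub>C T (e k)"])
      (simp_all add: eq)
  then show "S x = T x" using *[OF S] has_sum_unique by blast
qed

text \<open>Keeps the adjoint as an explicit operator. \<open>adjoint_op\<close> is a definite
  description, so it says something only once a candidate is exhibited; uniqueness of the partner
  then identifies the two.\<close>

definition adjoint_pair :: "('a::complex_hilbert \<Rightarrow> 'b::complex_hilbert) \<Rightarrow> ('b \<Rightarrow> 'a) \<Rightarrow> bool"
  where "adjoint_pair S T \<longleftrightarrow> (\<forall>x y. cinner (S x) y = cinner x (T y))"

lemma adjoint_pair_unique: "adjoint_pair S T \<Longrightarrow> adjoint_pair S T' \<Longrightarrow> T = T'"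
  unfolding adjoint_pair_def by (intro ext cinner_eqI) metis

lemma adjoint_pair_commute: "adjoint_pair S T \<Longrightarrow> adjoint_pair T S"
  unfolding adjoint_pair_def by (metis cinner_commute)

lemma adjoint_op_eqI: "adjoint_pair S T \<Longrightarrow> adjoint_op S = T"
  unfolding adjoint_op_def
  by (rule the_equality) (auto simp: adjoint_pair_def[symmetric] intro: adjoint_pair_unique)

text \<open>Common source of the unitary, of bounded diagonal operators and of the components of the
  difference. Partial shifts arise because targets may fall outside the index set. The series valid
  at every x is part of the conclusion because the adjoint is computed from it.\<close>

lemma weighted_shift_exists:
  fixes e :: "'i \<Rightarrow> 'a::complex_hilbert" and f :: "'j \<Rightarrow> 'b::complex_hilbert"
    and c :: "'i \<Rightarrow> real"
  assumes e: "orthonormal_basis I e" and f: "orthonormal_family (\<sigma> ` A) f"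
    and A: "A \<subseteq> I" and inj: "inj_on \<sigma> A" and c: "\<And>k. k \<in> A \<Longrightarrow> \<bar>c k\<bar> \<le> C"
  shows "\<exists>T. bounded_clinear T \<and>
    (\<forall>k\<in>I. T (e k) = (if k \<in> A then c k *\<^sub>R f (\<sigma> k) else 0)) \<and>
    (\<forall>x. ((\<lambda>k. (c k * cinner (e k) x) *\<^sub>C f (\<sigma> k)) has_sum T x) A)"
proof -
  define T where "T x = (\<Sum>\<^sub>\<infinity>k\<in>A. (c k * cinner (e k) x) *\<^sub>C f (\<sigma> k))" for x
  have fs: "orthonormal_family A (f \<circ> \<sigma>)"
    using f inj by (auto simp: orthonormal_family_def inj_on_def)
  have eA: "orthonormal_family A e"
    using orthonormal_family_subset[OF orthonormal_basis_family[OF e] A] .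
  have le: "(cmod (c k * cinner (e k) x))\<^sup>2 \<le> C\<^sup>2 * (cmod (cinner (e k) x))\<^sup>2" if "k \<in> A" for k x
    using c[OF that] by (auto simp: norm_mult power_mult_distrib abs_le_square_iff[symmetric]
        intro!: mult_right_mono)
  have sq: "(\<lambda>k. C\<^sup>2 * (cmod (cinner (e k) x))\<^sup>2) summable_on A" for x
    by (intro summable_on_cmult_right bessel_summable eA)
  have sm: "(\<lambda>k. (cmod (c k * cinner (e k) x))\<^sup>2) summable_on A" for x
    using sq by (rule summable_on_comparison_test) (use le in auto)
  have hs: "((\<lambda>k. (c k * cinner (e k) x) *\<^sub>C f (\<sigma> k)) has_sum T x) A" for x
    unfolding T_def using has_sum_infsum[OF riesz_fischer[OF fs sm[of x]]] by simp
  have T_eq: "T x = y" if "((\<lambda>k. (c k * cinner (e k) x) *\<^sub>C f (\<sigma> k)) has_sum y) A" for x y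
    using that hs has_sum_unique by blast
  have add: "T (x + y) = T x + T y" for x y
    by (rule T_eq) (use has_sum_add[OF hs[of x] hs[of y]] in
        \<open>simp add: cinner_add_right distrib_left scaleC_add_left\<close>)
  have scale: "T (d *\<^sub>C x) = d *\<^sub>C T x" for d x
  proof (rule T_eq)
    have "bounded_linear (\<lambda>x::'b. d *\<^sub>C x)"
      using bounded_clinear_scaleC bounded_clinear_def by blast
    from has_sum_bounded_linear[OF this hs[of x]]
    show "((\<lambda>k. (c k * cinner (e k) (d *\<^sub>C x)) *\<^sub>C f (\<sigma> k)) has_sum d *\<^sub>C T x) A"
      by (simp add: cinner_scaleC_right scaleC_scaleC mult.left_commute)
  qed
  \<comment> \<open>The coefficients of T x are \<open>c k * cinner (e k) x\<close>, so its squared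
    norm is the sum of their squares, and Bessel applies. The absolute value of C matters when A is
    empty, since then nothing makes C nonnegative.\<close>
  have bound: "norm (T x) \<le> norm x * \<bar>C\<bar>" for x
  proof -
    have "((\<lambda>k. cinner (T x) ((c k * cinner (e k) x) *\<^sub>C f (\<sigma> k))) has_sum cinner (T x) (T x)) A"
      by (rule has_sum_cinner[OF hs])
    moreover have "cinner (T x) ((c k * cinner (e k) x) *\<^sub>C f (\<sigma> k))
        = of_real ((cmod (c k * cinner (e k) x))\<^sup>2)" if "k \<in> A" for k
    proof -
      have "cinner (f (\<sigma> k)) (T x) = c k * cinner (e k) x"
        using cinner_infsum_orthonormal[OF fs sm[of x] that] by (simp add: T_def)
      then have "cinner (T x) (f (\<sigma> k)) = cnj (c k * cinner (e k) x)"
        by (metis cinner_commute)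
      then show ?thesis by (simp only: cinner_scaleC_right complex_norm_square)
    qed
    ultimately have "((\<lambda>k. complex_of_real ((cmod (c k * cinner (e k) x))\<^sup>2))
        has_sum cinner (T x) (T x)) A"
      by (simp only: cong: has_sum_cong)
    then have "((\<lambda>k. (cmod (c k * cinner (e k) x))\<^sup>2) has_sum (norm (T x))\<^sup>2) A"
      by (simp only: cinner_self has_sum_of_real_iff)
    then have "(norm (T x))\<^sup>2 \<le> (\<Sum>\<^sub>\<infinity>k\<in>A. C\<^sup>2 * (cmod (cinner (e k) x))\<^sup>2)"
      using has_sum_infsum[OF sq] le by (rule has_sum_mono)
    also have "\<dots> = C\<^sup>2 * (\<Sum>\<^sub>\<infinity>k\<in>A. (cmod (cinner (e k) x))\<^sup>2)"
      by (rule infsum_cmult_right')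
    also have "\<dots> \<le> C\<^sup>2 * (norm x)\<^sup>2"
      by (intro mult_left_mono bessel_summable eA) simp
    also have "\<dots> = (norm x * \<bar>C\<bar>)\<^sup>2" by (simp add: power_mult_distrib)
    finally show ?thesis by (simp add: power2_le_iff_abs_le)
  qed
  have bounded: "bounded_clinear T"
    unfolding bounded_clinear_def
    by (auto intro!: bounded_linear_intro[of _ "\<bar>C\<bar>"] add bound scale
        simp: scaleR_scaleC scale)
  have basis: "T (e k) = (if k \<in> A then c k *\<^sub>R f (\<sigma> k) else 0)" if k: "k \<in> I" for k
  proof (rule T_eq, cases "k \<in> A")
    case True
    then show "((\<lambda>l. (c l * cinner (e l) (e k)) *\<^sub>C f (\<sigma> l)) has_sum
        (if k \<in> A then c k *\<^sub>R f (\<sigma> k) else 0)) A"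
      using eA by (intro has_sum_finite_neutralI[of "{k}"])
        (auto simp: orthonormal_family_def scaleR_scaleC)
  next
    case False
    then show "((\<lambda>l. (c l * cinner (e l) (e k)) *\<^sub>C f (\<sigma> l)) has_sum
        (if k \<in> A then c k *\<^sub>R f (\<sigma> k) else 0)) A"
      using orthonormal_basis_family[OF e] k A
      by (intro has_sum_finite_neutralI[of "{}"]) (auto simp: orthonormal_family_def)
  qed
  from bounded basis hs show ?thesis by blast
qed

text \<open>The adjoint shifts back along the inverse of \<open>\<sigma>\<close> on its image with
  the same weights, which are real. Expanding both inner products yields one series, indexed once by
  A and once by its image.\<close>

lemma weighted_shift_adjoint:
  fixes e :: "'i \<Rightarrow> 'a::complex_hilbert" and f :: "'j \<Rightarrow> 'b::complex_hilbert"
    and c :: "'i \<Rightarrow> real"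
  assumes e: "orthonormal_basis I e" and f: "orthonormal_basis J f"
    and A: "A \<subseteq> I" "\<sigma> ` A \<subseteq> J" and inj: "inj_on \<sigma> A" and c: "\<And>k. k \<in> A \<Longrightarrow> \<bar>c k\<bar> \<le> C"
  shows "\<exists>T S. bounded_clinear T \<and> bounded_clinear S \<and> adjoint_pair T S \<and>
    (\<forall>k\<in>I. T (e k) = (if k \<in> A then c k *\<^sub>R f (\<sigma> k) else 0)) \<and>
    (\<forall>k\<in>A. S (f (\<sigma> k)) = c k *\<^sub>R e k)"
proof -
  let ?\<tau> = "inv_into A \<sigma>"
  have fA: "orthonormal_family (\<sigma> ` A) f"
    using orthonormal_family_subset[OF orthonormal_basis_family[OF f] A(2)] .
  have eA: "orthonormal_family (?\<tau> ` \<sigma> ` A) e"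
    using orthonormal_family_subset[OF orthonormal_basis_family[OF e] A(1)] inj
    by (simp add: inv_into_image_cancel)
  obtain T where T: "bounded_clinear T"
    "\<forall>k\<in>I. T (e k) = (if k \<in> A then c k *\<^sub>R f (\<sigma> k) else 0)"
    "\<And>x. ((\<lambda>k. (c k * cinner (e k) x) *\<^sub>C f (\<sigma> k)) has_sum T x) A"
    using weighted_shift_exists[where c = c and C = C, OF e fA A(1) inj c] by blast
  have c': "\<bar>(c \<circ> ?\<tau>) l\<bar> \<le> C" if "l \<in> \<sigma> ` A" for l
    using c inj that by auto
  obtain S where S: "bounded_clinear S"
    "\<forall>l\<in>J. S (f l) = (if l \<in> \<sigma> ` A then (c \<circ> ?\<tau>) l *\<^sub>R e (?\<tau> l) else 0)"
    "\<And>y. ((\<lambda>l. ((c \<circ> ?\<tau>) l * cinner (f l) y) *\<^sub>C e (?\<tau> l)) has_sum S y) (\<sigma> ` A)"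
    using weighted_shift_exists[where c = "c \<circ> ?\<tau>" and C = C,
        OF f eA A(2) inj_on_inv_into[OF subset_refl] c'] by blast
  have "adjoint_pair T S"
    unfolding adjoint_pair_def
  proof (intro allI)
    fix x y
    have "((\<lambda>k. cinner y ((c k * cinner (e k) x) *\<^sub>C f (\<sigma> k))) has_sum cinner y (T x)) A"
      by (rule has_sum_cinner[OF T(3)])
    then have "((\<lambda>k. cnj (cinner y ((c k * cinner (e k) x) *\<^sub>C f (\<sigma> k))))
        has_sum cnj (cinner y (T x))) A" by simp
    moreover have "cnj (cinner y ((c k * cinner (e k) x) *\<^sub>C f (\<sigma> k)))
        = c k * cinner x (e k) * cinner (f (\<sigma> k)) y" for k
      using cinner_commute[of x "e k"] cinner_commute[of "f (\<sigma> k)" y]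
      by (simp add: cinner_scaleC_right)
    ultimately have 1: "((\<lambda>k. c k * cinner x (e k) * cinner (f (\<sigma> k)) y)
        has_sum cinner (T x) y) A"
      using cinner_commute[of "T x" y] by simp
    have "((\<lambda>l. cinner x (((c \<circ> ?\<tau>) l * cinner (f l) y) *\<^sub>C e (?\<tau> l))) has_sum cinner x (S y)) (\<sigma> ` A)"
      by (rule has_sum_cinner[OF S(3)])
    then have "((\<lambda>l. cinner x (((c \<circ> ?\<tau>) l * cinner (f l) y) *\<^sub>C e (?\<tau> l))) \<circ> \<sigma>
        has_sum cinner x (S y)) A"
      by (simp add: has_sum_reindex[OF inj])
    then have "((\<lambda>k. c k * cinner x (e k) * cinner (f (\<sigma> k)) y) has_sum cinner x (S y)) A"
      using inj by (subst (asm) has_sum_cong[of A _ "\<lambda>k. c k * cinner x (e k) * cinner (f (\<sigma> k)) y"])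
        (auto simp: cinner_scaleC_right)
    with 1 show "cinner (T x) y = cinner x (S y)" by (rule has_sum_unique)
  qed
  moreover have "\<forall>k\<in>A. S (f (\<sigma> k)) = c k *\<^sub>R e k"
    using S(2) A inj by auto
  ultimately show ?thesis using T(1,2) S(1) by blast
qed

section \<open>Diagonal operators and the generated ideal\<close>

lemma diagonal_graph_basis:
  assumes "orthonormal_basis I e" "k \<in> I"
  shows "(e k, w k *\<^sub>R e k) \<in> diagonal_graph I e w"
  using assms by (auto simp: diagonal_graph_def orthonormal_basis_def cinner_scaleR_right)

lemma diagonal_graph_add:
  "(x, y) \<in> diagonal_graph I e w \<Longrightarrow> (x', y') \<in> diagonal_graph I e w
    \<Longrightarrow> (x + x', y + y') \<in> diagonal_graph I e w"
  by (simp add: diagonal_graph_def cinner_add_right distrib_left)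

lemma diagonal_graph_scaleC:
  "(x, y) \<in> diagonal_graph I e w \<Longrightarrow> (c *\<^sub>C x, c *\<^sub>C y) \<in> diagonal_graph I e w"
  by (simp add: diagonal_graph_def cinner_scaleC_right)

lemma finite_sum_in_Domain_diagonal_graph:
  assumes "orthonormal_basis I e" "finite F" "F \<subseteq> I"
  shows "(\<Sum>k\<in>F. a k *\<^sub>C e k) \<in> Domain (diagonal_graph I e w)"
  using assms(2,3)
proof induction
  case empty
  have "(0, 0) \<in> diagonal_graph I e w" by (simp add: diagonal_graph_def)
  then show ?case by (simp add: Domain.DomainI)
next
  case (insert k F)
  then obtain y where "((\<Sum>k\<in>F. a k *\<^sub>C e k), y) \<in> diagonal_graph I e w" by auto
  moreover have "(a k *\<^sub>C e k, a k *\<^sub>C w k *\<^sub>R e k) \<in> diagonal_graph I e w"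
    using insert by (intro diagonal_graph_scaleC diagonal_graph_basis assms) auto
  ultimately have "(a k *\<^sub>C e k + (\<Sum>k\<in>F. a k *\<^sub>C e k), a k *\<^sub>C w k *\<^sub>R e k + y)
      \<in> diagonal_graph I e w"
    by (intro diagonal_graph_add)
  then show ?case using insert.hyps by (simp add: Domain.DomainI)
qed

lemma Domain_diagonal_graph_dense:
  assumes e: "orthonormal_basis I e"
  shows "closure (Domain (diagonal_graph I e w)) = UNIV"
proof -
  have "x \<in> closure (Domain (diagonal_graph I e w))" for x
    unfolding closure_approachable
  proof (intro allI impI)
    fix d :: real assume "0 < d"
    then obtain F where "finite F" "F \<subseteq> I" "dist (\<Sum>k\<in>F. cinner (e k) x *\<^sub>C e k) x \<le> d/2"
      using has_sum_finite_approximation[OF orthonormal_expansion[OF e, of x], of "d/2"] by auto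
    then show "\<exists>y\<in>Domain (diagonal_graph I e w). dist y x < d"
      using \<open>0 < d\<close> finite_sum_in_Domain_diagonal_graph[OF e]
      by (intro bexI[of _ "\<Sum>k\<in>F. cinner (e k) x *\<^sub>C e k"]) auto
  qed
  then show ?thesis by auto
qed

lemma single_valued_diagonal_graph:
  "orthonormal_basis I e \<Longrightarrow> single_valued (diagonal_graph I e w)"
  by (auto simp: single_valued_def diagonal_graph_def intro: orthonormal_basis_eqI)

text \<open>Testing an adjoint pair on basis vectors, which lie in the domain, gives the coefficient
  equations. Conversely Parseval moves the real eigenvalues from one argument to the other, whether
  or not w is bounded.\<close>

lemma adjoint_diagonal_graph:
  assumes e: "orthonormal_basis I e"
  shows "adjoint_graph (diagonal_graph I e w) = diagonal_graph I e w"
proof (intro equalityI subrelI)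
  fix y z assume yz: "(y, z) \<in> adjoint_graph (diagonal_graph I e w)"
  have "cinner (w k *\<^sub>R e k) y = cinner (e k) z" if "k \<in> I" for k
    using yz diagonal_graph_basis[OF e that, of w] unfolding adjoint_graph_def by blast
  then show "(y, z) \<in> diagonal_graph I e w"
    by (simp add: diagonal_graph_def cinner_scaleR_left)
next
  fix y z assume yz: "(y, z) \<in> diagonal_graph I e w"
  have "cinner x' y = cinner x z" if x: "(x, x') \<in> diagonal_graph I e w" for x x'
  proof (rule has_sum_unique[OF parseval[OF e, of x' y]])
    have "cinner x' (e k) * cinner (e k) y = cinner x (e k) * cinner (e k) z" if "k \<in> I" for k
    proof -
      have "cinner x' (e k) = w k * cinner x (e k)"
        using x that cinner_commute[of x' "e k"] cinner_commute[of x "e k"]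
        by (simp add: diagonal_graph_def)
      then show ?thesis using yz that by (simp add: diagonal_graph_def)
    qed
    then show "((\<lambda>k. cinner x' (e k) * cinner (e k) y) has_sum cinner x z) I"
      using parseval[OF e, of x z] by (simp cong: has_sum_cong)
  qed
  then show "(y, z) \<in> adjoint_graph (diagonal_graph I e w)"
    unfolding adjoint_graph_def by blast
qed

lemma self_adjoint_diagonal_graph:
  "orthonormal_basis I e \<Longrightarrow> self_adjoint_graph (diagonal_graph I e w)"
  by (simp add: self_adjoint_graph_def single_valued_diagonal_graph Domain_diagonal_graph_dense
      adjoint_diagonal_graph)

lemma positive_diagonal_graph:
  assumes e: "orthonormal_basis I e" and w: "\<And>k. k \<in> I \<Longrightarrow> 0 \<le> w k"
  shows "positive_graph (diagonal_graph I e w)"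
  unfolding positive_graph_def
proof safe
  fix x y assume xy: "(x, y) \<in> diagonal_graph I e w"
  have "cinner x (e k) * cinner (e k) y = of_real (w k * (cmod (cinner (e k) x))\<^sup>2)"
    if "k \<in> I" for k
  proof -
    have "cinner x (e k) * cinner (e k) y = w k * (cinner (e k) x * cnj (cinner (e k) x))"
      using xy that cinner_commute[of x "e k"] by (simp add: diagonal_graph_def)
    then show ?thesis by (simp only: complex_norm_square[symmetric] of_real_mult)
  qed
  then have "((\<lambda>k. complex_of_real (w k * (cmod (cinner (e k) x))\<^sup>2)) has_sum cinner x y) I"
    using parseval[OF e, of x y] by (simp cong: has_sum_cong)
  from has_sum_Re[OF this] has_sum_Im[OF this]
  have "((\<lambda>k. w k * (cmod (cinner (e k) x))\<^sup>2) has_sum Re (cinner x y)) I"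
    and "((\<lambda>k. 0) has_sum Im (cinner x y)) I" by simp_all
  then have "0 \<le> Re (cinner x y)" "Im (cinner x y) = 0"
    using has_sum_nonneg[of "\<lambda>k. w k * (cmod (cinner (e k) x))\<^sup>2"] w
      has_sum_unique[OF _ has_sum_0_simp] by fastforce+
  then show "cinner x y \<in> \<real>\<^sub>\<ge>\<^sub>0" by (simp add: complex_nonneg_Reals_iff)
qed

lemma diagonal_operator_exists:
  fixes e :: "'i \<Rightarrow> 'a::complex_hilbert" and c :: "'i \<Rightarrow> real"
  assumes e: "orthonormal_basis I e" and c: "\<And>k. k \<in> I \<Longrightarrow> \<bar>c k\<bar> \<le> C"
  shows "\<exists>T. bounded_clinear T \<and> adjoint_pair T T \<and> (\<forall>k\<in>I. T (e k) = c k *\<^sub>R e k)"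
proof -
  obtain T S where T: "bounded_clinear T" "bounded_clinear S" "adjoint_pair T S"
    "\<forall>k\<in>I. T (e k) = c k *\<^sub>R e k" "\<forall>k\<in>I. S (e k) = c k *\<^sub>R e k"
    using weighted_shift_adjoint[OF e e, of I "\<lambda>k. k" c C] c by auto
  then have "S = T" by (intro bounded_clinear_ext[OF e]) auto
  with T show ?thesis by blast
qed

text \<open>The relation product needs an actual intermediate vector. The one for w is turned into
  one for u by the bounded diagonal operator of signs relating the two, and the signs cancel in the
  second factor. By symmetry of the hypothesis the inclusion gives equality.\<close>

lemma diagonal_graph_square_mono:
  assumes e: "orthonormal_basis I e" and w: "\<And>k. k \<in> I \<Longrightarrow> \<bar>w k\<bar> = \<bar>u k\<bar>"
  shows "diagonal_graph I e w O diagonal_graph I e w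
    \<subseteq> diagonal_graph I e u O diagonal_graph I e u"
proof safe
  fix x y z assume xy: "(x, y) \<in> diagonal_graph I e w" "(y, z) \<in> diagonal_graph I e w"
  define s :: "'a \<Rightarrow> real" where "s k = (if u k = w k then 1 else -1)" for k
  have s: "\<bar>s k\<bar> \<le> 1" for k by (simp add: s_def)
  have us: "s k * w k = u k" "u k * s k = w k" if "k \<in> I" for k
    using w[OF that] by (auto simp: s_def abs_if split: if_splits)
  obtain T where T: "adjoint_pair T T" "\<forall>k\<in>I. T (e k) = s k *\<^sub>R e k"
    using diagonal_operator_exists[OF e, of s 1] s by blast
  have Ty: "cinner (e k) (T y) = s k * cinner (e k) y" if "k \<in> I" for k
    using T that unfolding adjoint_pair_def by (metis cinner_scaleR_left)
  have "(x, T y) \<in> diagonal_graph I e u"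
    using xy(1) by (simp add: diagonal_graph_def Ty us(1)[symmetric])
  moreover have "(T y, z) \<in> diagonal_graph I e u"
    using xy(2) us(2) by (simp add: diagonal_graph_def Ty flip: of_real_mult mult.assoc)
  ultimately show "(x, z) \<in> diagonal_graph I e u O diagonal_graph I e u" by blast
qed

section \<open>Uniqueness of the positive square root in the diagonal case\<close>

lemma adjoint_graph_diff:
  "(x, y) \<in> adjoint_graph T \<Longrightarrow> (x', y') \<in> adjoint_graph T \<Longrightarrow> (x - x', y - y') \<in> adjoint_graph T"
  by (fastforce simp: adjoint_graph_def cinner_diff_right)

lemma adjoint_graph_scaleR:
  "(x, y) \<in> adjoint_graph T \<Longrightarrow> (r *\<^sub>R x, r *\<^sub>R y) \<in> adjoint_graph T"
  by (fastforce simp: adjoint_graph_def cinner_scaleR_right)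

text \<open>If \<open>S\<^sup>2\<close> has eigenvalue \<open>r\<^sup>2\<close> at \<open>x\<close>, then \<open>S x - r x\<close> is an eigenvector of \<open>S\<close> for the
  negative number \<open>-r\<close>, hence 0.\<close>

lemma positive_root_eigenvector:
  assumes S: "self_adjoint_graph S" "positive_graph S" and r: "0 < r"
    and x: "(x, (r * r) *\<^sub>R x) \<in> S O S"
  shows "(x, r *\<^sub>R x) \<in> S"
proof -
  have adj: "adjoint_graph S = S" using S by (simp add: self_adjoint_graph_def)
  obtain y where y: "(x, y) \<in> S" "(y, (r * r) *\<^sub>R x) \<in> S" using x by blast
  define d where "d = y - r *\<^sub>R x"
  have "(d, (r * r) *\<^sub>R x - r *\<^sub>R y) \<in> S"
    unfolding d_def
    using adjoint_graph_diff[of y "(r * r) *\<^sub>R x" S "r *\<^sub>R x" "r *\<^sub>R y"]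
      adjoint_graph_scaleR[of x y S r] y adj by simp
  moreover have "(r * r) *\<^sub>R x - r *\<^sub>R y = (- r) *\<^sub>R d"
    by (simp add: d_def scaleR_diff_right)
  ultimately have "cinner d ((- r) *\<^sub>R d) \<in> \<real>\<^sub>\<ge>\<^sub>0"
    using S(2) unfolding positive_graph_def by auto
  then have "0 \<le> - r * (norm d)\<^sup>2"
    by (simp add: cinner_scaleR_right cinner_minus_right cinner_self complex_nonneg_Reals_iff
        del: of_real_power)
  then have "d = 0" using r by (simp add: mult_le_0_iff)
  then show ?thesis using y(1) by (simp add: d_def)
qed

text \<open>A competing root S has every \<open>e k\<close> as an eigenvector for
  \<open>\<bar>w k\<bar>\<close>, by \<open>positive_root_eigenvector\<close>, whose strict
  positivity comes from w being nonzero. Self-adjointness of S then forces the coefficient equations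
  on each of its pairs.\<close>

lemma abs_diagonal_graph:
  assumes e: "orthonormal_basis I e" and w: "\<And>k. k \<in> I \<Longrightarrow> w k \<noteq> 0"
  shows "abs_graph (diagonal_graph I e w) = diagonal_graph I e (\<lambda>k. \<bar>w k\<bar>)"
    (is "_ = ?A")
proof -
  let ?T = "diagonal_graph I e w"
  have sq: "?A O ?A = ?T O adjoint_graph ?T"
    unfolding adjoint_diagonal_graph[OF e]
    by (intro equalityI diagonal_graph_square_mono[OF e]) simp_all
  show ?thesis
    unfolding abs_graph_def
  proof (rule the_equality)
    show "self_adjoint_graph ?A \<and> positive_graph ?A \<and> ?A O ?A = ?T O adjoint_graph ?T"
      using sq self_adjoint_diagonal_graph[OF e] positive_diagonal_graph[OF e] by simp
    fix S
    assume S: "self_adjoint_graph S \<and> positive_graph S \<and> S O S = ?T O adjoint_graph ?T"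
    then have adj: "adjoint_graph S = S" by (simp add: self_adjoint_graph_def)
    have ek: "(e k, \<bar>w k\<bar> *\<^sub>R e k) \<in> S" if k: "k \<in> I" for k
    proof (rule positive_root_eigenvector)
      have "(\<bar>w k\<bar> *\<^sub>R e k, \<bar>w k\<bar> *\<^sub>R \<bar>w k\<bar> *\<^sub>R e k) \<in> ?A"
        using diagonal_graph_scaleC[OF diagonal_graph_basis[OF e k, of "\<lambda>k. \<bar>w k\<bar>"]]
        by (metis scaleR_scaleC)
      then have "(e k, (\<bar>w k\<bar> * \<bar>w k\<bar>) *\<^sub>R e k) \<in> ?A O ?A"
        using diagonal_graph_basis[OF e k, of "\<lambda>k. \<bar>w k\<bar>"] by auto
      then show "(e k, (\<bar>w k\<bar> * \<bar>w k\<bar>) *\<^sub>R e k) \<in> S O S" using S sq by simp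
    qed (use S w[OF k] in auto)
    have sub: "S \<subseteq> ?A"
    proof (rule subrelI)
      fix x y assume "(x, y) \<in> S"
      then have "cinner (\<bar>w k\<bar> *\<^sub>R e k) x = cinner (e k) y" if "k \<in> I" for k
        using ek[OF that] adj unfolding adjoint_graph_def by blast
      then show "(x, y) \<in> ?A" by (simp add: diagonal_graph_def cinner_scaleR_left)
    qed
    \<comment> \<open>Taking adjoints reverses inclusions. As both graphs are their own adjoints,
      the inclusion of one in the other is an equality.\<close>
    then have "adjoint_graph ?A \<subseteq> adjoint_graph S" unfolding adjoint_graph_def by blast
    with sub show "S = ?A" using adj adjoint_diagonal_graph[OF e] by auto
  qed
qed

section \<open>Direct sums and unitary equivalence of diagonal operators\<close>

definition sum_basis :: "('i \<Rightarrow> 'a::complex_hilbert) \<Rightarrow> ('j \<Rightarrow> 'b::complex_hilbert) \<Rightarrow> 'i + 'j \<Rightarrow> 'a \<times> 'b"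
  where "sum_basis e f = case_sum (\<lambda>k. (e k, 0)) (\<lambda>l. (0, f l))"

lemma sum_basis_simps [simp]: "sum_basis e f (Inl k) = (e k, 0)" "sum_basis e f (Inr l) = (0, f l)"
  by (simp_all add: sum_basis_def)

lemma orthonormal_sum_basis:
  assumes "orthonormal_basis I e" "orthonormal_basis J f"
  shows "orthonormal_basis (I <+> J) (sum_basis e f)"
  using assms unfolding orthonormal_basis_def
  by (auto simp: cinner_prod_def Plus_def prod_eq_iff ball_Un)

lemma direct_sum_diagonal_graph:
  "direct_sum_graph (diagonal_graph I e w) (diagonal_graph J f u)
    = diagonal_graph (I <+> J) (sum_basis e f) (case_sum w u)"
  by (auto simp: direct_sum_graph_def diagonal_graph_def cinner_prod_def Plus_def ball_Un)

text \<open>This is the shift along \<open>\<sigma>\<close> with constant weight 1; the backward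
  shift inverts it since both compositions fix a basis.\<close>

lemma basis_bijection_unitary:
  fixes f :: "'i \<Rightarrow> 'a::complex_hilbert" and v :: "'j \<Rightarrow> 'b::complex_hilbert"
  assumes f: "orthonormal_basis K f" and v: "orthonormal_basis V v" and \<sigma>: "bij_betw \<sigma> K V"
  shows "\<exists>U. bounded_clinear U \<and> bounded_clinear (adjoint_op U) \<and>
    adjoint_pair U (adjoint_op U) \<and> unitary_op U \<and>
    (\<forall>k\<in>K. U (f k) = v (\<sigma> k)) \<and> (\<forall>k\<in>K. adjoint_op U (v (\<sigma> k)) = f k)"
proof -
  have im: "\<sigma> ` K = V" "inj_on \<sigma> K" using \<sigma> by (auto simp: bij_betw_def)
  obtain U S where U: "bounded_clinear U" "bounded_clinear S" "adjoint_pair U S"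
    "\<forall>k\<in>K. U (f k) = v (\<sigma> k)" "\<forall>k\<in>K. S (v (\<sigma> k)) = f k"
    using weighted_shift_adjoint[OF f v, of K \<sigma> "\<lambda>_. 1" 1] im by auto
  have id: "bounded_clinear id" by (simp add: bounded_clinear_def id_def bounded_linear_ident)
  have "S \<circ> U = id"
    using U by (intro bounded_clinear_ext[OF f] bounded_clinear_compose id) auto
  moreover have "U \<circ> S = id"
    using U im by (intro bounded_clinear_ext[OF v] bounded_clinear_compose id) auto
  ultimately have "unitary_op U"
    unfolding unitary_op_def adjoint_op_eqI[OF U(3)] using U(1) by simp
  then show ?thesis using U adjoint_op_eqI[OF U(3)] by metis
qed

text \<open>The coefficient of \<open>adjoint_op U z\<close> at \<open>f k\<close> is that of z at
  \<open>v (\<sigma> k)\<close>, so both graphs, domains included, are cut out by the same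
  equations.\<close>

lemma conjugate_diagonal_graph:
  assumes v: "orthonormal_basis V v" and \<sigma>: "\<sigma> ` K = V"
    and U: "adjoint_pair U (adjoint_op U)" "unitary_op U" "\<And>k. k \<in> K \<Longrightarrow> U (f k) = v (\<sigma> k)"
    and w: "\<And>k. k \<in> K \<Longrightarrow> w k = u (\<sigma> k)"
  shows "conjugate_graph U (diagonal_graph K f w) = diagonal_graph V v u"
proof -
  have inv: "U (adjoint_op U y) = y" "adjoint_op U (U x) = x" for x y
    using U(2) unfolding unitary_op_def by (metis comp_apply id_apply)+
  have coeff: "cinner (f k) (adjoint_op U z) = cinner (v (\<sigma> k)) z" if "k \<in> K" for k z
    using U(1) U(3)[OF that] unfolding adjoint_pair_def by metis
  have "(y, z) \<in> conjugate_graph U (diagonal_graph K f w)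
      \<longleftrightarrow> (adjoint_op U y, adjoint_op U z) \<in> diagonal_graph K f w" for y z
    unfolding conjugate_graph_def using inv by (auto intro: exI[of _ "adjoint_op U z"])
  also have "\<And>y z. (adjoint_op U y, adjoint_op U z) \<in> diagonal_graph K f w
      \<longleftrightarrow> (y, z) \<in> diagonal_graph V v u"
    using \<sigma> by (auto simp: diagonal_graph_def coeff w)
  finally show ?thesis by auto
qed

lemma bounded_diagonal_eqI:
  assumes e: "orthonormal_basis I e" and T: "bounded_clinear T" "\<forall>k\<in>I. T (e k) = w k *\<^sub>R e k"
  shows "bounded_diagonal I e w = T"
  unfolding bounded_diagonal_def
  by (rule the_equality) (use T in \<open>auto intro!: bounded_clinear_ext[OF e]\<close>)

section \<open>Membership in the generated ideal\<close>

lemma ideal_generated_zero: "(\<lambda>x. 0) \<in> ideal_generated T"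
proof -
  have "(\<lambda>x. 0 *\<^sub>C x) \<circ> T \<in> ideal_generated T"
    by (intro ideal_generated.mult_left ideal_generated.generator bounded_clinear_scaleC)
  then show ?thesis by (simp add: comp_def)
qed

lemma ideal_generated_sum:
  "finite M \<Longrightarrow> (\<And>m. m \<in> M \<Longrightarrow> R m \<in> ideal_generated T)
    \<Longrightarrow> (\<lambda>x. \<Sum>m\<in>M. R m x) \<in> ideal_generated T"
  by (induction M rule: finite_induct)
    (auto simp: ideal_generated_zero intro: ideal_generated.add)

text \<open>The quotients \<open>c k / w k\<close> are bounded by C, hence are the weights of a
  bounded shift Y, and Y after the generator T has weights \<open>c k\<close>. As T is self-adjoint,
  the adjoint is T after the adjoint of Y.\<close>

lemma weighted_shift_in_ideal:
  fixes e :: "'i \<Rightarrow> 'a::complex_hilbert" and c w :: "'i \<Rightarrow> real"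
  assumes e: "orthonormal_basis I e" and A: "A \<subseteq> I" "\<sigma> ` A \<subseteq> I" "inj_on \<sigma> A"
    and w: "\<And>k. k \<in> I \<Longrightarrow> 0 < w k" "\<And>k. k \<in> I \<Longrightarrow> w k \<le> 1"
    and c: "\<And>k. k \<in> A \<Longrightarrow> \<bar>c k\<bar> \<le> C * w k"
  shows "\<exists>R Q. bounded_clinear R \<and> adjoint_pair R Q \<and>
    (\<forall>k\<in>I. R (e k) = (if k \<in> A then c k *\<^sub>R e (\<sigma> k) else 0)) \<and>
    R \<in> ideal_generated (bounded_diagonal I e w) \<and> Q \<in> ideal_generated (bounded_diagonal I e w)"
proof -
  obtain T where T: "bounded_clinear T" "adjoint_pair T T" "\<forall>k\<in>I. T (e k) = w k *\<^sub>R e k"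
    using diagonal_operator_exists[OF e, of w 1] w by (auto simp: abs_of_pos)
  have T': "bounded_diagonal I e w = T" by (rule bounded_diagonal_eqI[OF e T(1,3)])
  have c': "\<bar>c k / w k\<bar> \<le> C" if "k \<in> A" for k
    using c[OF that] w(1)[of k] A(1) that by (auto simp: divide_le_eq)
  obtain Y Z where Y: "bounded_clinear Y" "bounded_clinear Z" "adjoint_pair Y Z"
    "\<forall>k\<in>I. Y (e k) = (if k \<in> A then (c k / w k) *\<^sub>R e (\<sigma> k) else 0)"
    using weighted_shift_adjoint[where c = "\<lambda>k. c k / w k" and C = C, OF e e A c'] by blast
  have "(Y \<circ> T) (e k) = (if k \<in> A then c k *\<^sub>R e (\<sigma> k) else 0)" if "k \<in> I" for k
    using Y(1,4) T(3) that w(1)[OF that]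
    by (simp add: bounded_clinear_def linear_simps(5))
  moreover have "adjoint_pair (Y \<circ> T) (T \<circ> Z)"
    using T(2) Y(3) by (simp add: adjoint_pair_def)
  ultimately show ?thesis
    unfolding T' using Y T
    by (intro exI[of _ "Y \<circ> T"] exI[of _ "T \<circ> Z"])
      (auto intro: bounded_clinear_compose ideal_generated.intros)
qed

text \<open>X agrees on the basis with a finite sum of partial shifts. Uniqueness of adjoints makes
  Z the sum of their adjoints, so one computation on the basis serves both operators.\<close>

lemma weighted_shift_sum_in_ideal:
  fixes e :: "'i \<Rightarrow> 'a::complex_hilbert" and w :: "'i \<Rightarrow> real" and c :: "'m \<Rightarrow> 'i \<Rightarrow> real"
  assumes e: "orthonormal_basis I e" and M: "finite M"
    and A: "\<And>m. m \<in> M \<Longrightarrow> A m \<subseteq> I" "\<And>m. m \<in> M \<Longrightarrow> \<sigma> m ` A m \<subseteq> I"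
      "\<And>m. m \<in> M \<Longrightarrow> inj_on (\<sigma> m) (A m)"
    and w: "\<And>k. k \<in> I \<Longrightarrow> 0 < w k" "\<And>k. k \<in> I \<Longrightarrow> w k \<le> 1"
    and c: "\<And>m k. m \<in> M \<Longrightarrow> k \<in> A m \<Longrightarrow> \<bar>c m k\<bar> \<le> C * w k"
    and X: "bounded_clinear X" "adjoint_pair X Z"
      "\<And>k. k \<in> I \<Longrightarrow> X (e k) = (\<Sum>m\<in>M. if k \<in> A m then c m k *\<^sub>R e (\<sigma> m k) else 0)"
  shows "X \<in> ideal_generated (bounded_diagonal I e w)"
    and "Z \<in> ideal_generated (bounded_diagonal I e w)"
proof -
  let ?K = "ideal_generated (bounded_diagonal I e w)"
  have "\<forall>m\<in>M. \<exists>RQ. bounded_clinear (fst RQ) \<and> adjoint_pair (fst RQ) (snd RQ) \<and>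
    (\<forall>k\<in>I. fst RQ (e k) = (if k \<in> A m then c m k *\<^sub>R e (\<sigma> m k) else 0)) \<and>
    fst RQ \<in> ?K \<and> snd RQ \<in> ?K"
    using weighted_shift_in_ideal[OF e A w c] by simp
  from bchoice[OF this] obtain RQ where RQ: "\<forall>m\<in>M. bounded_clinear (fst (RQ m)) \<and> adjoint_pair (fst (RQ m)) (snd (RQ m)) \<and>
    (\<forall>k\<in>I. fst (RQ m) (e k) = (if k \<in> A m then c m k *\<^sub>R e (\<sigma> m k) else 0)) \<and>
    fst (RQ m) \<in> ?K \<and> snd (RQ m) \<in> ?K" by blast
  have eq: "X = (\<lambda>x. \<Sum>m\<in>M. fst (RQ m) x)"
    using RQ X by (intro bounded_clinear_ext[OF e] bounded_clinear_sum) auto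
  have "adjoint_pair (\<lambda>x. \<Sum>m\<in>M. fst (RQ m) x) (\<lambda>x. \<Sum>m\<in>M. snd (RQ m) x)"
    using RQ by (auto simp: adjoint_pair_def cinner_sum_left cinner_sum_right intro!: sum.cong)
  then have eq': "Z = (\<lambda>x. \<Sum>m\<in>M. snd (RQ m) x)"
    using X(2) eq adjoint_pair_unique by blast
  show "X \<in> ?K" unfolding eq using RQ by (intro ideal_generated_sum[OF M]) auto
  show "Z \<in> ?K" unfolding eq' using RQ by (intro ideal_generated_sum[OF M]) auto
qed

section \<open>Matrix entries\<close>

text \<open>The correction to the leading power in a q-number: [m] is q^(1-m)
  \<open>q_gap q m\<close> / (1 - q^2). It tends to 1 as m grows and is at least 1 - q^2 for m \<ge>
  1.\<close>

definition q_gap :: "real \<Rightarrow> real \<Rightarrow> real"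
  where "q_gap q m = 1 - q powr (2 * m)"

text \<open>Extracting the leading powers of \<open>q\<close> from the \<open>q\<close>-numbers brings the coefficients of \<open>\<pi>\<close>,
  the diagonal and the off-diagonal entries of the matrices of \<open>\<pi>'\<close> into the following forms.\<close>

definition haar_entry :: "real \<Rightarrow> real \<Rightarrow> real \<Rightarrow> real \<Rightarrow> real \<Rightarrow> real \<Rightarrow> real"
  where "haar_entry q p m1 m2 w1 w2 =
    q powr p * sqrt (q_gap q m1) * sqrt (q_gap q m2) / (sqrt (q_gap q w1) * sqrt (q_gap q w2))"

definition spinor_entry :: "real \<Rightarrow> real \<Rightarrow> real \<Rightarrow> real \<Rightarrow> real \<Rightarrow> real"
  where "spinor_entry q p m1 m2 w = q powr p * sqrt (q_gap q m1) * sqrt (q_gap q m2) / q_gap q w"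

definition mixing_entry :: "real \<Rightarrow> real \<Rightarrow> real \<Rightarrow> real \<Rightarrow> real \<Rightarrow> real \<Rightarrow> real"
  where "mixing_entry q p m1 m2 w1 w2 =
    q powr p * sqrt (q_gap q m1) * sqrt (q_gap q m2) * (1 - q\<^sup>2) / (q_gap q w1 * q_gap q w2)"

text \<open>The square in the denominator accounts for up to two gaps there, each at least 1 - q^2
  because its argument is at least 1.\<close>

definition entry_bound :: "real \<Rightarrow> real \<Rightarrow> real"
  where "entry_bound q n = q powr n / (1 - q\<^sup>2)\<^sup>2"

text \<open>The matrices of the components of \<open>U (P \<oplus> P) U\<^sup>*\<close> raising and lowering \<open>n\<close>, where \<open>f\<close>
  gives the corresponding coefficients of \<open>P\<close>. The vectors \<open>u\<close> with \<open>j = n + 1/2\<close> come from the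
  first summand of \<open>L\<^sub>2(h) \<oplus> L\<^sub>2(h)\<close>; raising \<open>n\<close> turns them into \<open>d\<close>.\<close>

definition lift_plus :: "(real \<Rightarrow> real \<Rightarrow> real \<Rightarrow> real) \<Rightarrow> real \<Rightarrow> real \<Rightarrow> real \<Rightarrow> spin \<Rightarrow> spin \<Rightarrow> real"
  where "lift_plus f n i j = mat2 (if j = n + 1/2 then 0 else f n i (j + 1/2)) 0
    (if j = n + 1/2 then f n i n else 0) (f n i (j - 1/2))"

definition lift_minus :: "(real \<Rightarrow> real \<Rightarrow> real \<Rightarrow> real) \<Rightarrow> real \<Rightarrow> real \<Rightarrow> real \<Rightarrow> spin \<Rightarrow> spin \<Rightarrow> real"
  where "lift_minus f n i j = mat2 (if j = n + 1/2 then f n i n else f n i (j + 1/2)) 0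
    0 (f n i (j - 1/2))"

text \<open>The last clause records that weights move in unit steps: below the top weight there is
  room for a full 1. It separates the edge j = n + 1/2 from j \<le> n - 1/2.\<close>

lemma weightsD:
  assumes "i \<in> weights l"
  shows "- l \<le> i" "i \<le> l" "i = l \<or> i \<le> l - 1 \<or> 2 * l \<notin> \<nat>"
proof -
  obtain k where k: "i = - l + real k" "real k \<le> 2 * l" using assms by (auto simp: weights_def)
  then show "- l \<le> i" "i \<le> l" by auto
  show "i = l \<or> i \<le> l - 1 \<or> 2 * l \<notin> \<nat>"
  proof (cases "2 * l \<in> \<nat>")
    case True
    then obtain m where "2 * l = real m" by (auto elim: Nats_cases)
    moreover have "k = m \<or> real k \<le> real m - 1" using k calculation by linarith
    ultimately show ?thesis using k by auto
  qed simp
qed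

lemma half_naturalsD: "n \<in> half_naturals \<Longrightarrow> 2 * n \<in> \<nat> \<and> 0 \<le> n \<and> (n = 0 \<or> 1/2 \<le> n)"
proof -
  assume "n \<in> half_naturals"
  then obtain k where "n = real k / 2" by (auto simp: half_naturals_def)
  then have k: "2 * n = real k" by simp
  then have "2 * n \<in> \<nat>" by (metis of_nat_in_Nats)
  moreover have "k = 0 \<or> 1 \<le> real k" by (cases k) auto
  ultimately show ?thesis using k by auto
qed

lemma v_index_Up:
  assumes "(Up, n, i, j) \<in> v_index"
  shows "0 \<le> n" "n = 0 \<or> 1/2 \<le> n" "- n \<le> i" "i \<le> n" "- n - 1/2 \<le> j" "j \<le> n + 1/2"
    "j = n + 1/2 \<or> j \<le> n - 1/2"
proof -
  have n: "n \<in> half_naturals" "i \<in> weights n" "j \<in> weights (n + 1/2)"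
    using assms by (auto simp: v_index_def)
  then have "2 * (n + 1/2) \<in> \<nat>" using half_naturalsD[OF n(1)] by (simp add: distrib_left)
  with n half_naturalsD[OF n(1)] weightsD[OF n(2)] weightsD[OF n(3)]
  show "0 \<le> n" "n = 0 \<or> 1/2 \<le> n" "- n \<le> i" "i \<le> n" "- n - 1/2 \<le> j" "j \<le> n + 1/2"
    "j = n + 1/2 \<or> j \<le> n - 1/2" by auto
qed

lemma v_index_Down:
  assumes "(Down, n, i, j) \<in> v_index"
  shows "1/2 \<le> n" "- n \<le> i" "i \<le> n" "- n + 1/2 \<le> j" "j \<le> n - 1/2"
proof -
  have n: "n \<in> half_naturals" "0 < n" "i \<in> weights n" "j \<in> weights (n - 1/2)"
    using assms by (auto simp: v_index_def)
  with half_naturalsD[OF n(1)] weightsD[OF n(3)] weightsD[OF n(4)]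
  show "1/2 \<le> n" "- n \<le> i" "i \<le> n" "- n + 1/2 \<le> j" "j \<le> n - 1/2" by auto
qed

context
  fixes q :: real
  assumes q0: "0 < q" and q1: "q < 1"
begin

section \<open>Normal forms of the coefficients\<close>

lemma one_minus_q2: "0 < 1 - q\<^sup>2" "1 - q\<^sup>2 \<le> 1"
proof -
  have "q * q < 1 * 1" using q0 q1 by (intro mult_strict_mono) auto
  then show "0 < 1 - q\<^sup>2" "1 - q\<^sup>2 \<le> 1" by (simp_all add: power2_eq_square)
qed

lemma q_number_gap: "q_number q m = q powr (1 - m) * q_gap q m / (1 - q\<^sup>2)"
proof -
  have "q powr (1 - m) * q_gap q m = q * q powr (- m) - q * q powr m"
    using q0 by (simp add: q_gap_def powr_diff powr_minus powr_add right_diff_distrib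
        field_simps flip: powr_add)
  moreover have "q - inverse q = - (1 - q\<^sup>2) / q"
    using q0 by (simp add: field_simps power2_eq_square)
  moreover have "(a - b) / (- d / q) = (q * b - q * a) / d" if "0 < d" for a b d
    using that q0 by (simp add: field_simps)
  ultimately show ?thesis
    unfolding q_number_def using one_minus_q2 by metis
qed

lemma sqrt_powr: "sqrt (q powr x) = q powr (x / 2)"
  using q0 by (simp add: powr_half_sqrt[symmetric] powr_powr)

lemma sqrt_q_number: "sqrt (q_number q m) = q powr ((1 - m) / 2) * sqrt (q_gap q m) / sqrt (1 - q\<^sup>2)"
  by (simp add: q_number_gap real_sqrt_mult real_sqrt_divide sqrt_powr)

text \<open>Each q-number contributes the exponent 1 - m, halved under a root and negated in the
  denominator. The constant parts of these exponents cancel, and so do the factors 1 - q^2.\<close>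

lemma spinor_entryI:
  assumes p: "p = x + y + m3 - (m1 + m2) / 2"
  shows "q powr x * sqrt (q_number q m1) * (q powr y * (sqrt (q_number q m2) / q_number q m3))
    = spinor_entry q p m1 m2 m3"
proof -
  have "p = x + (1 - m1) / 2 + y + (1 - m2) / 2 - (1 - m3)"
    using p by (simp add: field_simps)
  then have "q powr p = q powr x * q powr ((1 - m1) / 2) * q powr y * q powr ((1 - m2) / 2)
      / q powr (1 - m3)"
    by (simp add: powr_add powr_diff)
  moreover have "X * (A * g1 / r) * (Y * (B * g2 / r / (C * g3 / d))) = X * A * Y * B / C * g1 * g2 / g3"
    if "d = r * r" "0 < r" for X A g1 r Y B g2 C g3 d :: real
    using that by simp
  from this[of "1 - q\<^sup>2" "sqrt (1 - q\<^sup>2)"] one_minus_q2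
  have "q powr x * sqrt (q_number q m1) * (q powr y * (sqrt (q_number q m2) / q_number q m3))
    = q powr x * q powr ((1 - m1) / 2) * q powr y * q powr ((1 - m2) / 2) / q powr (1 - m3)
      * sqrt (q_gap q m1) * sqrt (q_gap q m2) / q_gap q m3"
    unfolding sqrt_q_number unfolding q_number_gap by simp
  ultimately show ?thesis
    unfolding spinor_entry_def by simp
qed

text \<open>Compared with \<open>spinor_entryI\<close>, the second q-number in the denominator adds
  m4 - 1 to the exponent and leaves one factor 1 - q^2 in the numerator.\<close>

lemma mixing_entryI:
  assumes p: "p = x + y + m3 + m4 - 1 - (m1 + m2) / 2"
  shows "q powr x * sqrt (q_number q m1) *
      (q powr y * (sqrt (q_number q m2) / (q_number q m3 * q_number q m4)))
    = mixing_entry q p m1 m2 m3 m4"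
proof -
  have "q powr x * sqrt (q_number q m1) *
      (q powr y * (sqrt (q_number q m2) / (q_number q m3 * q_number q m4)))
    = spinor_entry q (x + y + m3 - (m1 + m2) / 2) m1 m2 m3 / q_number q m4"
    unfolding spinor_entryI[OF refl, of x m1 y m2 m3, symmetric] by simp
  also have "\<dots> = mixing_entry q p m1 m2 m3 m4"
  proof -
    have "p = x + y + m3 - (m1 + m2) / 2 - (1 - m4)" using p by simp
    then have "q powr p = q powr (x + y + m3 - (m1 + m2) / 2) / q powr (1 - m4)"
      by (simp only: powr_diff)
    then show ?thesis
      unfolding spinor_entry_def mixing_entry_def q_number_gap using one_minus_q2 by simp
  qed
  finally show ?thesis .
qed

lemma mat_a_plus_entries:
  "mat_a_plus q n i j Up Up = spinor_entry q 0 (n + i + 1) (n + j + 3/2) (2 * n + 2)"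
  "mat_a_plus q n i j Down Up
    = mixing_entry q (3 * n + j + 3/2) (n + i + 1) (n - j + 1/2) (2 * n + 1) (2 * n + 2)"
  "mat_a_plus q n i j Up Down = 0"
  "mat_a_plus q n i j Down Down = spinor_entry q 0 (n + i + 1) (n + j + 1/2) (2 * n + 1)"
  unfolding mat_a_plus_def mat2.simps
  by (rule spinor_entryI mixing_entryI | simp add: field_simps)+

lemma mat_a_minus_entries:
  "mat_a_minus q n i j Up Up = spinor_entry q (2 * n + i + j + 3/2) (n - i) (n - j + 1/2) (2 * n + 1)"
  "mat_a_minus q n i j Down Up = 0"
  "mat_a_minus q n i j Up Down
    = - mixing_entry q (3 * n + i) (n - i) (n + j + 1/2) (2 * n) (2 * n + 1)"
  "mat_a_minus q n i j Down Down
    = spinor_entry q (2 * n + i + j + 1/2) (n - i) (n - j - 1/2) (2 * n)"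
  unfolding mat_a_minus_def mat2.simps mult_minus_left mult_minus_right neg_equal_iff_equal
  by (rule spinor_entryI mixing_entryI | simp add: field_simps)+

lemma mat_b_plus_entries:
  "mat_b_plus q n i j Up Up = spinor_entry q (n + j + 1/2) (n + i + 1) (n - j + 3/2) (2 * n + 2)"
  "mat_b_plus q n i j Down Up
    = - mixing_entry q (2 * n) (n + i + 1) (n + j + 1/2) (2 * n + 1) (2 * n + 2)"
  "mat_b_plus q n i j Up Down = 0"
  "mat_b_plus q n i j Down Down = spinor_entry q (n + j - 1/2) (n + i + 1) (n - j + 1/2) (2 * n + 1)"
proof -
  show "mat_b_plus q n i j Up Up = spinor_entry q (n + j + 1/2) (n + i + 1) (n - j + 3/2) (2 * n + 2)"
  proof -
    \<comment> \<open>This entry has no second power of q, so y = 0 is supplied explicitly.\<close>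
    have p: "n + j + 1/2 = (i + j - 1/2) / 2 + 0 + (2 * n + 2) - ((n + i + 1) + (n - j + 3/2)) / 2"
      by (simp add: field_simps)
    show ?thesis unfolding mat_b_plus_def mat2.simps using spinor_entryI[OF p] q0 by simp
  qed
qed (unfold mat_b_plus_def mat2.simps mult_minus_left mult_minus_right neg_equal_iff_equal,
    (rule spinor_entryI mixing_entryI | simp add: field_simps)+)

lemma mat_b_minus_entries:
  "mat_b_minus q n i j Up Up = - spinor_entry q (n + i) (n - i) (n + j + 1/2) (2 * n + 1)"
  "mat_b_minus q n i j Down Up = 0"
  "mat_b_minus q n i j Up Down
    = - mixing_entry q (4 * n + i + j - 1/2) (n - i) (n - j + 1/2) (2 * n) (2 * n + 1)"
  "mat_b_minus q n i j Down Down = - spinor_entry q (n + i) (n - i) (n + j - 1/2) (2 * n)"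
proof -
  show "mat_b_minus q n i j Down Down = - spinor_entry q (n + i) (n - i) (n + j - 1/2) (2 * n)"
  proof -
    have p: "n + i = (i + j - 1/2) / 2 + 0 + 2 * n - ((n - i) + (n + j - 1/2)) / 2"
      by (simp add: field_simps)
    show ?thesis unfolding mat_b_minus_def mat2.simps using spinor_entryI[OF p] q0 by simp
  qed
qed (unfold mat_b_minus_def mat2.simps mult_minus_left mult_minus_right neg_equal_iff_equal,
    (rule spinor_entryI mixing_entryI | simp add: field_simps)+)

lemma haar_entryI:
  assumes "x = 2 * p" "y1 = 2 * m1" "y2 = 2 * m2" "z1 = 2 * w1" "z2 = 2 * w2"
  shows "sqrt (q powr x * ((1 - q powr y2) * (1 - q powr y1) / ((1 - q powr z1) * (1 - q powr z2))))
    = haar_entry q p m1 m2 w1 w2"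
  unfolding assms haar_entry_def q_gap_def[symmetric]
  by (simp add: real_sqrt_mult real_sqrt_divide sqrt_powr)

lemma a_plus_entry: "a_plus q n i j
    = haar_entry q (2 * n + i + j + 1) (n - i + 1) (n - j + 1) (2 * n + 1) (2 * n + 2)"
  unfolding a_plus_def by (rule haar_entryI) (simp_all add: field_simps)

lemma a_minus_entry: "n \<noteq> 0 \<Longrightarrow> a_minus q n i j = haar_entry q 0 (n + i) (n + j) (2 * n) (2 * n + 1)"
  using haar_entryI[of 0 0 "2 * n + 2 * i" "n + i" "2 * n + 2 * j" "n + j" "4 * n" "2 * n"
      "4 * n + 2" "2 * n + 1"] q0
  unfolding a_minus_def by simp

lemma b_plus_entry: "b_plus q n i j
    = - haar_entry q (n + j) (n + i + 1) (n - j + 1) (2 * n + 1) (2 * n + 2)"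
  unfolding b_plus_def neg_equal_iff_equal by (rule haar_entryI) (simp_all add: field_simps)

lemma b_minus_entry:
  "n \<noteq> 0 \<Longrightarrow> b_minus q n i j = haar_entry q (n + i) (n - i) (n + j) (2 * n) (2 * n + 1)"
  using haar_entryI[of "2 * (n + i)" "n + i" "2 * n - 2 * i" "n - i" "2 * n + 2 * j" "n + j" "4 * n"
      "2 * n" "4 * n + 2" "2 * n + 1"]
  unfolding b_minus_def by simp

section \<open>Estimates for gaps and normal forms\<close>

lemma powr_le_of_ge: "a \<le> b \<Longrightarrow> q powr b \<le> q powr a"
  using q0 q1 by (simp add: powr_mono')

lemma q_gap_bounds: "0 \<le> m \<Longrightarrow> 0 \<le> q_gap q m" "q_gap q m \<le> 1"
  "1 \<le> m \<Longrightarrow> 1 - q\<^sup>2 \<le> q_gap q m"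
proof -
  show "0 \<le> m \<Longrightarrow> 0 \<le> q_gap q m" using powr_le_of_ge[of 0 "2 * m"] q0 by (simp add: q_gap_def)
  show "q_gap q m \<le> 1" by (simp add: q_gap_def)
  show "1 \<le> m \<Longrightarrow> 1 - q\<^sup>2 \<le> q_gap q m"
    using powr_le_of_ge[of 2 "2 * m"] q0 by (simp add: q_gap_def flip: powr_numeral)
qed

lemma sqrt_q_gap_bounds: "0 \<le> m \<Longrightarrow> 0 \<le> sqrt (q_gap q m)" "sqrt (q_gap q m) \<le> 1"
  "1 \<le> m \<Longrightarrow> sqrt (1 - q\<^sup>2) \<le> sqrt (q_gap q m)"
  using q_gap_bounds[of m] by auto

lemma sqrt_diff_le:
  fixes a b :: real
  assumes "0 \<le> a" "a \<le> b"
  shows "sqrt b - sqrt a \<le> sqrt (b - a)"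
  using sqrt_add_le_add_sqrt[of a "b - a"] assms by simp

text \<open>The square root is not Lipschitz at 0, where gaps may lie. Bounding a difference of
  roots by the root of the difference halves the exponent 2m, and the rate q^m is still what a
  generator with weights q^n can absorb.\<close>

lemma sqrt_q_gap_diff:
  assumes "0 \<le> m" "0 \<le> m'" "l \<le> m" "l \<le> m'"
  shows "\<bar>sqrt (q_gap q m) - sqrt (q_gap q m')\<bar> \<le> q powr l"
proof -
  have *: "\<bar>sqrt (q_gap q m) - sqrt (q_gap q m')\<bar> \<le> q powr l"
    if "0 \<le> m" "m \<le> m'" "l \<le> m" for m m'
  proof -
    have le: "q_gap q m \<le> q_gap q m'" using powr_le_of_ge[of "2 * m" "2 * m'"] that by (simp add: q_gap_def)
    have "sqrt (q_gap q m') - sqrt (q_gap q m) \<le> sqrt (q_gap q m' - q_gap q m)"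
      using le q_gap_bounds(1)[OF that(1)] by (rule sqrt_diff_le[rotated])
    also have "\<dots> \<le> sqrt (q powr (2 * m))" by (simp add: q_gap_def)
    also have "\<dots> = q powr m" by (simp add: sqrt_powr)
    also have "\<dots> \<le> q powr l" using that by (intro powr_le_of_ge)
    finally show ?thesis using le by (simp add: abs_if)
  qed
  show ?thesis
    using *[of m m'] *[of m' m] assms by (cases "m \<le> m'") (auto simp: abs_minus_commute)
qed

text \<open>Only the second numerator gap and the denominator differ. The gap contributes one unit
  of \<open>entry_bound\<close>, the denominator two, whence the factor 3.\<close>

lemma haar_spinor_diff:
  assumes "p' = p" "m1' = m1" "0 \<le> p" "0 \<le> m1" "0 \<le> m2" "0 \<le> m2'"
    and w: "1 \<le> w1" "1 \<le> w2" "1 \<le> w" "n \<le> w1" "n \<le> w2" "n \<le> w"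
    and m2: "m2 = m2' \<or> n \<le> p + m2 \<and> n \<le> p + m2'"
  shows "\<bar>haar_entry q p m1 m2 w1 w2 - spinor_entry q p' m1' m2' w\<bar> \<le> 3 * entry_bound q n"
proof -
  define P s S S' A B W where "P = q powr p" and "s = sqrt (q_gap q m1)"
    and "S = sqrt (q_gap q m2)" and "S' = sqrt (q_gap q m2')"
    and "A = sqrt (q_gap q w1)" and "B = sqrt (q_gap q w2)" and "W = sqrt (q_gap q w)"
  define \<delta> where "\<delta> = 1 - q\<^sup>2"
  have \<delta>: "0 < \<delta>" "\<delta> \<le> 1" using one_minus_q2 by (simp_all add: \<delta>_def)
  have P: "0 \<le> P" "P \<le> 1" using assms q0 powr_le_of_ge[of 0 p] by (auto simp: P_def)
  have s: "0 \<le> s" "s \<le> 1" and S': "0 \<le> S'" "S' \<le> 1"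
    using sqrt_q_gap_bounds assms by (auto simp: s_def S'_def)
  have A: "sqrt \<delta> \<le> A" "A \<le> 1" and B: "sqrt \<delta> \<le> B" and W: "sqrt \<delta> \<le> W" "W \<le> 1"
    using sqrt_q_gap_bounds w by (auto simp: A_def B_def W_def \<delta>_def)
  have AB: "\<delta> \<le> A * B" using mult_mono[OF A(1) B] A B \<delta> by simp
  have WW: "\<delta> \<le> W * W" using mult_mono[OF W(1) W(1)] W \<delta> by simp
  have gw: "q_gap q w = W * W" using q_gap_bounds(1)[of w] w by (simp add: W_def)
  have WA: "\<bar>W - A\<bar> \<le> q powr n" and WB: "\<bar>W - B\<bar> \<le> q powr n"
    unfolding W_def A_def B_def using w by (auto intro!: sqrt_q_gap_diff)
  have PS: "P * \<bar>S - S'\<bar> \<le> q powr n"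
  proof (cases "m2 = m2'")
    case False
    \<comment> \<open>The roots alone are only known to differ by q^(n-p); the common prefactor q^p
      makes up the rest.\<close>
    then have "\<bar>S - S'\<bar> \<le> q powr (n - p)"
      unfolding S_def S'_def using assms by (intro sqrt_q_gap_diff) auto
    then have "P * \<bar>S - S'\<bar> \<le> P * q powr (n - p)" using P by (intro mult_left_mono)
    also have "\<dots> = q powr n" by (simp add: P_def flip: powr_add)
    finally show ?thesis .
  qed (simp add: S_def S'_def)
  have inv: "\<bar>1 / (A * B) - 1 / (W * W)\<bar> \<le> 2 * q powr n / \<delta>\<^sup>2"
  proof -
    \<comment> \<open>W^2 - A B is telescoped through W A into two differences of roots, each at
      most q^n.\<close>
    have "1 / (A * B) - 1 / (W * W) = (W * (W - A) + A * (W - B)) / ((A * B) * (W * W))"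
    proof -
      have "1 / x - 1 / y = (y - x) / (x * y)" if "0 < x" "0 < y" for x y :: real
        using that by (simp add: field_simps)
      from this[of "A * B" "W * W"] show ?thesis using AB WW \<delta> by (simp add: algebra_simps)
    qed
    moreover have "\<bar>W * (W - A) + A * (W - B)\<bar> \<le> 2 * q powr n"
    proof -
      have "0 \<le> W" "0 \<le> A" using A(1) W(1) \<delta> by (meson less_imp_le order_trans real_sqrt_ge_0_iff)+
      then have "\<bar>W * (W - A)\<bar> \<le> 1 * q powr n" "\<bar>A * (W - B)\<bar> \<le> 1 * q powr n"
        using A W WA WB unfolding abs_mult by (intro mult_mono; simp)+
      then show ?thesis by linarith
    qed
    moreover have "\<delta>\<^sup>2 \<le> (A * B) * (W * W)"
      unfolding power2_eq_square using AB WW \<delta> by (intro mult_mono) auto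
    moreover have "0 < (A * B) * (W * W)" using AB WW \<delta> by (simp add: mult_pos_pos)
    ultimately show ?thesis using \<delta> by (auto simp: abs_divide abs_of_pos intro!: frac_le)
  qed
  have eq: "haar_entry q p m1 m2 w1 w2 - spinor_entry q p' m1' m2' w
      = s * ((P * (S - S')) / (A * B)) + P * s * S' * (1 / (A * B) - 1 / (W * W))"
    unfolding haar_entry_def spinor_entry_def assms(1,2) gw
    by (simp add: P_def s_def S_def S'_def A_def B_def diff_divide_distrib algebra_simps)
  have 1: "\<bar>s * ((P * (S - S')) / (A * B))\<bar> \<le> 1 * (q powr n / \<delta>)"
  proof -
    have "\<bar>(P * (S - S')) / (A * B)\<bar> = P * \<bar>S - S'\<bar> / (A * B)"
    proof -
      have "\<bar>A * B\<bar> = A * B" using AB \<delta> by simp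
      then show ?thesis by (simp only: abs_divide abs_mult[of P "S - S'"] abs_of_nonneg[OF P(1)])
    qed
    also have "\<dots> \<le> q powr n / \<delta>" using PS AB \<delta> by (intro frac_le) auto
    finally show ?thesis using s unfolding abs_mult by (intro mult_mono) auto
  qed
  have 2: "\<bar>P * s * S' * (1 / (A * B) - 1 / (W * W))\<bar> \<le> 1 * (2 * q powr n / \<delta>\<^sup>2)"
  proof -
    have "P * s * S' \<le> 1" using P s S' by (simp add: mult_le_one)
    moreover have "0 \<le> P * s * S'" using P s S' by simp
    ultimately have "\<bar>P * s * S'\<bar> \<le> 1" by simp
    then show ?thesis using inv unfolding abs_mult[of "P * s * S'"] by (intro mult_mono) auto
  qed
  have 3: "q powr n / \<delta> \<le> q powr n / \<delta>\<^sup>2"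
    using \<delta> by (intro divide_left_mono) (auto simp: power2_eq_square mult_left_le)
  have "\<bar>x + y\<bar> \<le> b1 + b2" if "\<bar>x\<bar> \<le> 1 * b0" "\<bar>y\<bar> \<le> 1 * b2" "b0 \<le> b1" for x y b0 b1 b2 :: real
    using that by linarith
  from this[OF 1 2 3] have "\<bar>haar_entry q p m1 m2 w1 w2 - spinor_entry q p' m1' m2' w\<bar>
      \<le> q powr n / \<delta>\<^sup>2 + 2 * q powr n / \<delta>\<^sup>2"
    unfolding eq .
  then show ?thesis by (simp add: \<delta>_def entry_bound_def)
qed

text \<open>For entries small without any cancellation: the roots are at most 1, so the explicit
  power of q decides. The denominator is weakened to (1 - q^2)^2 to share one bound with the
  differences.\<close>

lemma powr_entry_bound:
  assumes "n \<le> p" "0 \<le> m1" "0 \<le> m2" "1 - q\<^sup>2 \<le> d"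
  shows "\<bar>q powr p * sqrt (q_gap q m1) * sqrt (q_gap q m2) / d\<bar> \<le> entry_bound q n"
proof -
  have "q powr p * (sqrt (q_gap q m1) * sqrt (q_gap q m2)) \<le> q powr n * 1"
    using assms sqrt_q_gap_bounds by (intro mult_mono powr_le_of_ge mult_le_one) auto
  moreover have "(1 - q\<^sup>2)\<^sup>2 \<le> d"
    using assms(4) one_minus_q2 mult_left_le[of "1 - q\<^sup>2" "1 - q\<^sup>2"]
    unfolding power2_eq_square[of "1 - q\<^sup>2"] by linarith
  ultimately have "q powr p * (sqrt (q_gap q m1) * sqrt (q_gap q m2)) / d \<le> q powr n / (1 - q\<^sup>2)\<^sup>2"
    using one_minus_q2 assms sqrt_q_gap_bounds by (intro frac_le) auto
  then show ?thesis
    using assms one_minus_q2 sqrt_q_gap_bounds by (simp add: mult.assoc entry_bound_def)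
qed

lemma haar_entry_bound:
  assumes "n \<le> p" "0 \<le> m1" "0 \<le> m2" "1 \<le> w1" "1 \<le> w2"
  shows "\<bar>haar_entry q p m1 m2 w1 w2\<bar> \<le> entry_bound q n"
proof -
  have "sqrt (1 - q\<^sup>2) * sqrt (1 - q\<^sup>2) \<le> sqrt (q_gap q w1) * sqrt (q_gap q w2)"
    using assms one_minus_q2 sqrt_q_gap_bounds by (intro mult_mono) auto
  then show ?thesis
    unfolding haar_entry_def using assms one_minus_q2 by (intro powr_entry_bound) auto
qed

lemma spinor_entry_bound:
  assumes "n \<le> p" "0 \<le> m1" "0 \<le> m2" "1 \<le> w"
  shows "\<bar>spinor_entry q p m1 m2 w\<bar> \<le> entry_bound q n"
  unfolding spinor_entry_def using assms q_gap_bounds by (intro powr_entry_bound) auto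

lemma mixing_entry_bound:
  assumes "n \<le> p" "0 \<le> m1" "0 \<le> m2" "1 \<le> w1" "1 \<le> w2"
  shows "\<bar>mixing_entry q p m1 m2 w1 w2\<bar> \<le> entry_bound q n"
proof -
  have "(1 - q\<^sup>2) * (1 - q\<^sup>2) \<le> q_gap q w1 * q_gap q w2"
    using assms one_minus_q2 q_gap_bounds by (intro mult_mono) auto
  then have "1 - q\<^sup>2 \<le> q_gap q w1 * q_gap q w2 / (1 - q\<^sup>2)"
    using one_minus_q2 by (simp add: le_divide_eq)
  from powr_entry_bound[OF assms(1-3) this] show ?thesis
    unfolding mixing_entry_def by simp
qed

lemma entry_bound_nonneg: "0 \<le> entry_bound q n"
  by (simp add: entry_bound_def)

text \<open>On the diagonal away from the edge, the arguments of the j-gap are n - j + 1/2 and n - j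
  + 3/2 in one order or the other. Adding the exponent p cancels j and leaves at least 3n + i + 1,
  which is enough because i \<ge> -n.\<close>

lemma alpha_plus_bound:
  assumes "(s, n, i, j) \<in> v_index" "(t, n + 1/2, i - 1/2, j - 1/2) \<in> v_index"
  shows "\<bar>lift_plus (a_plus q) n i j t s - mat_a_plus' q n i j t s\<bar> \<le> 3 * entry_bound q n"
proof (cases s)
  case Up
  note I = v_index_Up[OF assms(1)[unfolded Up]]
  show ?thesis
  proof (cases t)
    assume t: "t = Up"
    show ?thesis
    proof (cases "j = n + 1/2")
      case True
      \<comment> \<open>At the edge the exponent is 3n + i + 2, so this entry is small although the
        lifted one is 0.\<close>
      have "\<bar>mat_a_minus q (n + 1/2) (i - 1/2) (j - 1/2) Up Up\<bar> \<le> entry_bound q n"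
        unfolding mat_a_minus_entries using I True by (intro spinor_entry_bound) auto
      then show ?thesis using entry_bound_nonneg[of n]
        by (simp add: Up t True lift_plus_def mat_a_plus'_def)
    next
      case False
      have "\<bar>a_plus q n i (j + 1/2) - mat_a_minus q (n + 1/2) (i - 1/2) (j - 1/2) Up Up\<bar>
          \<le> 3 * entry_bound q n"
        unfolding mat_a_minus_entries a_plus_entry using I False
        by (intro haar_spinor_diff) auto
      then show ?thesis using False by (simp add: Up t lift_plus_def mat_a_plus'_def)
    qed
  next
    assume t: "t = Down"
    note J = v_index_Down[OF assms(2)[unfolded t]]
    have "\<bar>mat_a_minus q (n + 1/2) (i - 1/2) (j - 1/2) Up Down\<bar> \<le> entry_bound q n"
      unfolding mat_a_minus_entries abs_minus_cancel using I J by (intro mixing_entry_bound) auto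
    \<comment> \<open>Raising n takes the vector with j = n off the edge of the first copy, so the
      lifted matrix mixes spins there; the coefficient has exponent 3n + i + 1.\<close>
    moreover have "\<bar>a_plus q n i n\<bar> \<le> entry_bound q n"
      unfolding a_plus_entry using I J by (intro haar_entry_bound) auto
    ultimately show ?thesis
      using entry_bound_nonneg[of n]
      by (cases "j = n + 1/2") (simp_all add: Up t lift_plus_def mat_a_plus'_def)
  qed
next
  case Down
  note I = v_index_Down[OF assms(1)[unfolded Down]]
  show ?thesis
  proof (cases t)
    assume t: "t = Up"
    show ?thesis using entry_bound_nonneg[of n]
      by (simp add: Down t lift_plus_def mat_a_plus'_def mat_a_minus_entries)
  next
    assume t: "t = Down"
    note J = v_index_Down[OF assms(2)[unfolded t]]
    have "\<bar>a_plus q n i (j - 1/2) - mat_a_minus q (n + 1/2) (i - 1/2) (j - 1/2) Down Down\<bar>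
        \<le> 3 * entry_bound q n"
      unfolding mat_a_minus_entries a_plus_entry using I J
      by (intro haar_spinor_diff) auto
    then show ?thesis by (simp add: Down t lift_plus_def mat_a_plus'_def)
  qed
qed

text \<open>The diagonal entries carry no power of q, so the gaps themselves must match. They do,
  except that at the edge the arguments are 2n and 2n + 1, both at least n.\<close>

lemma alpha_minus_bound:
  assumes "(s, n, i, j) \<in> v_index" "(t, n - 1/2, i - 1/2, j - 1/2) \<in> v_index"
  shows "\<bar>lift_minus (a_minus q) n i j t s - mat_a_minus' q n i j t s\<bar> \<le> 3 * entry_bound q n"
proof (cases s)
  case Up
  note I = v_index_Up[OF assms(1)[unfolded Up]]
  show ?thesis
  proof (cases t)
    assume t: "t = Up"
    note J = v_index_Up[OF assms(2)[unfolded t]]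
    have n: "n \<noteq> 0" using J by simp
    show ?thesis
    proof (cases "j = n + 1/2")
      case True
      have "\<bar>a_minus q n i n - mat_a_plus q (n - 1/2) (i - 1/2) (j - 1/2) Up Up\<bar>
          \<le> 3 * entry_bound q n"
        unfolding mat_a_plus_entries a_minus_entry[OF n] using I J True
        by (intro haar_spinor_diff) auto
      then show ?thesis using True by (simp add: Up t lift_minus_def mat_a_minus'_def)
    next
      case False
      have "\<bar>a_minus q n i (j + 1/2) - mat_a_plus q (n - 1/2) (i - 1/2) (j - 1/2) Up Up\<bar>
          \<le> 3 * entry_bound q n"
        unfolding mat_a_plus_entries a_minus_entry[OF n] using I J False
        by (intro haar_spinor_diff) auto
      then show ?thesis using False by (simp add: Up t lift_minus_def mat_a_minus'_def)
    qed
  next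
    assume t: "t = Down"
    show ?thesis using entry_bound_nonneg[of n]
      by (simp add: Up t lift_minus_def mat_a_minus'_def mat_a_plus_entries)
  qed
next
  case Down
  note I = v_index_Down[OF assms(1)[unfolded Down]]
  have n: "n \<noteq> 0" using I by simp
  show ?thesis
  proof (cases t)
    assume t: "t = Up"
    note J = v_index_Up[OF assms(2)[unfolded t]]
    have "\<bar>mat_a_plus q (n - 1/2) (i - 1/2) (j - 1/2) Down Up\<bar> \<le> entry_bound q n"
      unfolding mat_a_plus_entries using I J by (intro mixing_entry_bound) auto
    then show ?thesis using entry_bound_nonneg[of n]
      by (simp add: Down t lift_minus_def mat_a_minus'_def)
  next
    assume t: "t = Down"
    note J = v_index_Down[OF assms(2)[unfolded t]]
    have "\<bar>a_minus q n i (j - 1/2) - mat_a_plus q (n - 1/2) (i - 1/2) (j - 1/2) Down Down\<bar>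
        \<le> 3 * entry_bound q n"
      unfolding mat_a_plus_entries a_minus_entry[OF n] using I J
      by (intro haar_spinor_diff) auto
    then show ?thesis by (simp add: Down t lift_minus_def mat_a_minus'_def)
  qed
qed

text \<open>The matrices describe \<open>- \<beta>\<close>, so the difference of the operators
  appears as a sum of entries. The exponent contains j and the j-gap contains -j; together they give
  at least 2n.\<close>

lemma beta_plus_bound:
  assumes "(s, n, i, j) \<in> v_index" "(t, n + 1/2, i + 1/2, j - 1/2) \<in> v_index"
  shows "\<bar>lift_plus (b_plus q) n i j t s + mat_b_plus q n i j t s\<bar> \<le> 3 * entry_bound q n"
proof (cases s)
  case Up
  note I = v_index_Up[OF assms(1)[unfolded Up]]
  show ?thesis
  proof (cases t)
    assume t: "t = Up"
    show ?thesis
    proof (cases "j = n + 1/2")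
      case True
      have "\<bar>mat_b_plus q n i j Up Up\<bar> \<le> entry_bound q n"
        unfolding mat_b_plus_entries using I True by (intro spinor_entry_bound) auto
      then show ?thesis using entry_bound_nonneg[of n]
        by (simp add: Up t True lift_plus_def)
    next
      case False
      have "\<bar>- b_plus q n i (j + 1/2) - mat_b_plus q n i j Up Up\<bar> \<le> 3 * entry_bound q n"
        unfolding mat_b_plus_entries b_plus_entry minus_minus using I False
        by (intro haar_spinor_diff) auto
      then show ?thesis using False by (simp add: Up t lift_plus_def)
    qed
  next
    assume t: "t = Down"
    note J = v_index_Down[OF assms(2)[unfolded t]]
    have "\<bar>mat_b_plus q n i j Down Up\<bar> \<le> entry_bound q n"
      unfolding mat_b_plus_entries abs_minus_cancel using I J by (intro mixing_entry_bound) auto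
    moreover have "\<bar>b_plus q n i n\<bar> \<le> entry_bound q n"
      unfolding b_plus_entry abs_minus_cancel using I J by (intro haar_entry_bound) auto
    ultimately show ?thesis
      using entry_bound_nonneg[of n]
      by (cases "j = n + 1/2") (simp_all add: Up t lift_plus_def)
  qed
next
  case Down
  note I = v_index_Down[OF assms(1)[unfolded Down]]
  show ?thesis
  proof (cases t)
    assume t: "t = Up"
    show ?thesis using entry_bound_nonneg[of n]
      by (simp add: Down t lift_plus_def mat_b_plus_entries)
  next
    assume t: "t = Down"
    note J = v_index_Down[OF assms(2)[unfolded t]]
    have "\<bar>- b_plus q n i (j - 1/2) - mat_b_plus q n i j Down Down\<bar> \<le> 3 * entry_bound q n"
      unfolding mat_b_plus_entries b_plus_entry minus_minus using I J
      by (intro haar_spinor_diff) auto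
    then show ?thesis by (simp add: Down t lift_plus_def)
  qed
qed

text \<open>The exponent n + i and the i-gap agree throughout. The j-gaps differ at the edge only,
  with arguments 2n and 2n + 1, and the negative sign of the matrix entry turns the sum into a
  difference of normal forms.\<close>

lemma beta_minus_bound:
  assumes "(s, n, i, j) \<in> v_index" "(t, n - 1/2, i + 1/2, j - 1/2) \<in> v_index"
  shows "\<bar>lift_minus (b_minus q) n i j t s + mat_b_minus q n i j t s\<bar> \<le> 3 * entry_bound q n"
proof (cases s)
  case Up
  note I = v_index_Up[OF assms(1)[unfolded Up]]
  show ?thesis
  proof (cases t)
    assume t: "t = Up"
    note J = v_index_Up[OF assms(2)[unfolded t]]
    have n: "n \<noteq> 0" using J by simp
    show ?thesis
    proof (cases "j = n + 1/2")
      case True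
      have "\<bar>b_minus q n i n - - mat_b_minus q n i j Up Up\<bar> \<le> 3 * entry_bound q n"
        unfolding mat_b_minus_entries minus_minus b_minus_entry[OF n] using I J True
        by (intro haar_spinor_diff) auto
      then show ?thesis using True by (simp add: Up t lift_minus_def)
    next
      case False
      have "\<bar>b_minus q n i (j + 1/2) - - mat_b_minus q n i j Up Up\<bar> \<le> 3 * entry_bound q n"
        unfolding mat_b_minus_entries minus_minus b_minus_entry[OF n] using I J False
        by (intro haar_spinor_diff) auto
      then show ?thesis using False by (simp add: Up t lift_minus_def)
    qed
  next
    assume t: "t = Down"
    show ?thesis using entry_bound_nonneg[of n]
      by (simp add: Up t lift_minus_def mat_b_minus_entries)
  qed
next
  case Down
  note I = v_index_Down[OF assms(1)[unfolded Down]]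
  have n: "n \<noteq> 0" using I by simp
  show ?thesis
  proof (cases t)
    assume t: "t = Up"
    note J = v_index_Up[OF assms(2)[unfolded t]]
    have "\<bar>mat_b_minus q n i j Up Down\<bar> \<le> entry_bound q n"
      unfolding mat_b_minus_entries abs_minus_cancel using I J by (intro mixing_entry_bound) auto
    then show ?thesis using entry_bound_nonneg[of n]
      by (simp add: Down t lift_minus_def)
  next
    assume t: "t = Down"
    note J = v_index_Down[OF assms(2)[unfolded t]]
    have "\<bar>b_minus q n i (j - 1/2) - - mat_b_minus q n i j Down Down\<bar> \<le> 3 * entry_bound q n"
      unfolding mat_b_minus_entries minus_minus b_minus_entry[OF n] using I J
      by (intro haar_spinor_diff) auto
    then show ?thesis by (simp add: Down t lift_minus_def)
  qed
qed

end

section \<open>The unitary\<close>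

lemma spinor_basis_column:
  "spinor_basis v \<Longrightarrow> column v m s n i j =
    (if (Up, n, i, j) \<in> v_index then m Up s *\<^sub>R v (Up, n, i, j) else 0) +
    (if (Down, n, i, j) \<in> v_index then m Down s *\<^sub>R v (Down, n, i, j) else 0)"
  by (auto simp: column_def spinor_basis_def)

text \<open>X splits into eight partial shifts, one for each source spin, target spin and direction
  of n. Entry bounds are asked only where source and target both exist, because v vanishes outside
  its index set.\<close>

lemma band_operator_in_ideal_Kq:
  fixes v :: "spin \<times> real \<times> real \<times> real \<Rightarrow> 'h::complex_hilbert"
  assumes q: "0 < q" "q < 1" and v: "spinor_basis v"
    and X: "bounded_clinear X" "adjoint_pair X Z"
      "\<And>s n i j. (s, n, i, j) \<in> v_index \<Longrightarrow> X (v (s, n, i, j)) =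
        column v (cp n i j) s (n + 1/2) (i + di) (j + dj) +
        column v (cm n i j) s (n - 1/2) (i + di) (j + dj)"
    and cp: "\<And>s t n i j. (s, n, i, j) \<in> v_index \<Longrightarrow> (t, n + 1/2, i + di, j + dj) \<in> v_index
      \<Longrightarrow> \<bar>cp n i j t s\<bar> \<le> C * q powr n"
    and cm: "\<And>s t n i j. (s, n, i, j) \<in> v_index \<Longrightarrow> (t, n - 1/2, i + di, j + dj) \<in> v_index
      \<Longrightarrow> \<bar>cm n i j t s\<bar> \<le> C * q powr n"
  shows "X \<in> ideal_Kq q v" "Z \<in> ideal_Kq q v"
proof -
  define w :: "spin \<times> real \<times> real \<times> real \<Rightarrow> real" where "w = (\<lambda>(s, n, i, j). q powr n)"
  define M :: "(spin \<times> spin \<times> bool) set"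
    where "M = {(Up, Up, True), (Up, Up, False), (Up, Down, True), (Up, Down, False),
      (Down, Up, True), (Down, Up, False), (Down, Down, True), (Down, Down, False)}"
  define \<sigma> :: "spin \<times> spin \<times> bool \<Rightarrow> spin \<times> real \<times> real \<times> real \<Rightarrow> spin \<times> real \<times> real \<times> real"
    where "\<sigma> = (\<lambda>(s, t, p) (s', n, i, j). (t, if p then n + 1/2 else n - 1/2, i + di, j + dj))"
  \<comment> \<open>\<open>\<sigma>\<close> forgets the source spin; fixing it in the domain makes
    each piece injective.\<close>
  define A where "A = (\<lambda>(s, t, p). {k \<in> v_index. fst k = s \<and> \<sigma> (s, t, p) k \<in> v_index})"
  define c :: "spin \<times> spin \<times> bool \<Rightarrow> spin \<times> real \<times> real \<times> real \<Rightarrow> real"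
    where "c = (\<lambda>(s, t, p) (s', n, i, j). if p then cp n i j t s else cm n i j t s)"
  have e: "orthonormal_basis v_index v" using v by (simp add: spinor_basis_def)
  have fin: "finite M" by (simp add: M_def)
  have A: "A m \<subseteq> v_index" "\<sigma> m ` A m \<subseteq> v_index" "inj_on (\<sigma> m) (A m)" for m
    by (auto simp: A_def \<sigma>_def inj_on_def split: prod.splits if_splits)
  have w: "0 < w k" "w k \<le> 1" if "k \<in> v_index" for k
  proof -
    obtain s n i j where k: "k = (s, n, i, j)" by (cases k)
    have "0 \<le> n" using that v_index_Up[of n i j] v_index_Down[of n i j] unfolding k
      by (cases s) auto
    then show "0 < w k" "w k \<le> 1" using q powr_mono'[of 0 n q] by (auto simp: k w_def)
  qed
  have c: "\<bar>c m k\<bar> \<le> C * w k" if "k \<in> A m" for m k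
    using that cp cm by (auto simp: A_def c_def w_def \<sigma>_def split: prod.splits if_splits)
  have X3: "X (v k) = (\<Sum>m\<in>M. if k \<in> A m then c m k *\<^sub>R v (\<sigma> m k) else 0)"
    if "k \<in> v_index" for k
  proof -
    obtain s n i j where k: "k = (s, n, i, j)" by (cases k)
    show ?thesis
      unfolding k using X(3)[OF that[unfolded k]] that unfolding k spinor_basis_column[OF v]
      by (cases s) (simp_all add: M_def A_def c_def \<sigma>_def)
  qed
  show "X \<in> ideal_Kq q v" "Z \<in> ideal_Kq q v"
    using weighted_shift_sum_in_ideal[where w = w and \<sigma> = \<sigma> and c = c and A = A and M = M,
        OF e fin A w c X(1,2) X3]
    unfolding ideal_Kq_def w_def[symmetric] by blast+
qed

section \<open>Half-integer weights and the bijection of the index sets\<close>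

lemma weights_half_steps:
  shows "j \<in> weights l \<Longrightarrow> j - 1/2 \<in> weights (l + 1/2)"
    and "j \<in> weights l \<Longrightarrow> j + 1/2 \<in> weights (l + 1/2)"
    and "2 * l \<in> \<nat> \<Longrightarrow> j \<in> weights l \<Longrightarrow> j \<noteq> l \<Longrightarrow> j + 1/2 \<in> weights (l - 1/2)"
    and "j \<in> weights l \<Longrightarrow> j \<noteq> - l \<Longrightarrow> j - 1/2 \<in> weights (l - 1/2)"
proof -
  assume "j \<in> weights l"
  then obtain k where k: "j = - l + real k" "real k \<le> 2 * l" by (auto simp: weights_def)
  have "j - 1/2 = - (l + 1/2) + real k" "real k \<le> 2 * (l + 1/2)" using k by auto
  then show "j - 1/2 \<in> weights (l + 1/2)" unfolding weights_def by blast
  have "j + 1/2 = - (l + 1/2) + real (Suc k)" "real (Suc k) \<le> 2 * (l + 1/2)" using k by auto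
  then show "j + 1/2 \<in> weights (l + 1/2)" unfolding weights_def by blast
  show "j + 1/2 \<in> weights (l - 1/2)" if "2 * l \<in> \<nat>" "j \<noteq> l"
  proof -
    obtain m where m: "2 * l = real m" using \<open>2 * l \<in> \<nat>\<close> by (auto elim: Nats_cases)
    then have "k \<noteq> m" "k \<le> m" using k \<open>j \<noteq> l\<close> by auto
    then have "j + 1/2 = - (l - 1/2) + real k" "real k \<le> 2 * (l - 1/2)" using k m by auto
    then show ?thesis unfolding weights_def by blast
  qed
  show "j - 1/2 \<in> weights (l - 1/2)" if "j \<noteq> - l"
  proof -
    have "k \<noteq> 0" using k that by auto
    then have "j - 1/2 = - (l - 1/2) + real (k - 1)" "real (k - 1) \<le> 2 * (l - 1/2)"
      using k by (auto simp: of_nat_diff)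
    then show ?thesis unfolding weights_def by blast
  qed
qed

lemma top_weight: "2 * l \<in> \<nat> \<Longrightarrow> l \<in> weights l"
  by (auto simp: weights_def elim!: Nats_cases intro!: exI[of _ "nat \<lfloor>2 * l\<rfloor>"])

lemma half_naturals_steps:
  "n \<in> half_naturals \<Longrightarrow> n + 1/2 \<in> half_naturals"
  "n \<in> half_naturals \<Longrightarrow> n \<noteq> 0 \<Longrightarrow> n - 1/2 \<in> half_naturals"
proof -
  assume "n \<in> half_naturals"
  then obtain k where k: "n = real k / 2" by (auto simp: half_naturals_def)
  then have "n + 1/2 = real (Suc k) / 2" by simp
  then show "n + 1/2 \<in> half_naturals" unfolding half_naturals_def by blast
  assume "n \<noteq> 0"
  then have "n - 1/2 = real (k - 1) / 2" using k by (cases k) (auto simp: field_simps)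
  then show "n - 1/2 \<in> half_naturals" unfolding half_naturals_def by blast
qed

lemma e_index_iff: "(n, i, j) \<in> e_index \<longleftrightarrow> n \<in> half_naturals \<and> i \<in> weights n \<and> j \<in> weights n"
  by (simp add: e_index_def)

lemma v_index_iff:
  "(Up, n, i, j) \<in> v_index \<longleftrightarrow> n \<in> half_naturals \<and> i \<in> weights n \<and> j \<in> weights (n + 1/2)"
  "(Down, n, i, j) \<in> v_index \<longleftrightarrow>
    n \<in> half_naturals \<and> 0 < n \<and> i \<in> weights n \<and> j \<in> weights (n - 1/2)"
  by (auto simp: v_index_def)

fun spinor_label :: "(real \<times> real \<times> real) + (real \<times> real \<times> real) \<Rightarrow> spin \<times> real \<times> real \<times> real"
  where
    "spinor_label (Inl (n, i, j)) = (if j = n then (Up, n, i, n + 1/2) else (Down, n, i, j + 1/2))"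
  | "spinor_label (Inr (n, i, j)) = (Up, n, i, j - 1/2)"

fun haar_label :: "spin \<times> real \<times> real \<times> real \<Rightarrow> (real \<times> real \<times> real) + (real \<times> real \<times> real)"
  where
    "haar_label (Up, n, i, j) = (if j = n + 1/2 then Inl (n, i, n) else Inr (n, i, j + 1/2))"
  | "haar_label (Down, n, i, j) = Inl (n, i, j - 1/2)"

lemma haar_label_in:
  assumes "k \<in> v_index"
  shows "haar_label k \<in> e_index <+> e_index" "spinor_label (haar_label k) = k"
proof -
  obtain s n i j where k: "k = (s, n, i, j)" by (cases k)
  have "haar_label k \<in> e_index <+> e_index \<and> spinor_label (haar_label k) = k"
  proof (cases s)
    case Up
    have I: "n \<in> half_naturals" "i \<in> weights n" "j \<in> weights (n + 1/2)"
      using assms by (auto simp: k Up v_index_iff)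
    have N: "2 * n \<in> \<nat>" "2 * (n + 1/2) \<in> \<nat>"
      using half_naturalsD[OF I(1)] half_naturalsD[OF half_naturals_steps(1)[OF I(1)]] by auto
    show ?thesis
      using I weights_half_steps(3)[OF N(2) I(3)] top_weight[OF N(1)]
      by (auto simp: k Up e_index_iff)
  next
    case Down
    have I: "n \<in> half_naturals" "i \<in> weights n" "j \<in> weights (n - 1/2)"
      using assms by (auto simp: k Down v_index_iff)
    have "j - 1/2 \<noteq> n" using v_index_Down(5)[of n i j] assms by (auto simp: k Down)
    then show ?thesis
      using I weights_half_steps(1)[OF I(3)] by (auto simp: k Down e_index_iff)
  qed
  then show "haar_label k \<in> e_index <+> e_index" "spinor_label (haar_label k) = k" by auto
qed

lemma spinor_label_in:
  assumes "k \<in> e_index <+> e_index"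
  shows "spinor_label k \<in> v_index" "haar_label (spinor_label k) = k"
proof -
  have "spinor_label k \<in> v_index \<and> haar_label (spinor_label k) = k"
  proof (cases k)
    case (Inl x)
    obtain n i j where x: "x = (n, i, j)" by (cases x)
    have I: "n \<in> half_naturals" "i \<in> weights n" "j \<in> weights n"
      using assms by (auto simp: Inl x e_index_iff)
    have N: "2 * n \<in> \<nat>" "0 \<le> n" using half_naturalsD[OF I(1)] by auto
    have "0 < n" if "j \<noteq> n" using weightsD[OF I(3)] that N by (cases "n = 0") auto
    then show ?thesis
      using I weights_half_steps(3)[OF N(1) I(3)]
        weights_half_steps(2)[OF top_weight[OF N(1)]]
      by (auto simp: Inl x e_index_iff v_index_iff)
  next
    case (Inr x)
    obtain n i j where x: "x = (n, i, j)" by (cases x)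
    have I: "n \<in> half_naturals" "i \<in> weights n" "j \<in> weights n"
      using assms by (auto simp: Inr x e_index_iff)
    have "j - 1/2 \<noteq> n + 1/2" using weightsD[OF I(3)] by auto
    then show ?thesis
      using I weights_half_steps(1)[OF I(3)] by (auto simp: Inr x e_index_iff v_index_iff)
  qed
  then show "spinor_label k \<in> v_index" "haar_label (spinor_label k) = k" by auto
qed

lemma bij_betw_spinor_label: "bij_betw spinor_label (e_index <+> e_index) v_index"
  by (rule bij_betw_byWitness[where f' = haar_label])
    (use haar_label_in spinor_label_in in blast)+

text \<open>The modulus makes the second summand constant 2n + 1 on level n, as D is on
  \<open>Up\<close>; the two cases of D_1 separate the edge j = n from the vectors sent to
  \<open>Down\<close>.\<close>

lemma D_eigenvalue_spinor_label:
  assumes "k \<in> e_index <+> e_index"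
  shows "case_sum D1_eigenvalue (\<lambda>k. \<bar>D2_eigenvalue k\<bar>) k = D_eigenvalue (spinor_label k)"
  using assms
  by (auto simp: D1_eigenvalue_def D2_eigenvalue_def e_index_iff dest!: half_naturalsD)

lemma D2_eigenvalue_nonzero: "k \<in> e_index \<Longrightarrow> D2_eigenvalue k \<noteq> 0"
  by (auto simp: D2_eigenvalue_def e_index_def dest!: half_naturalsD split: if_splits)

text \<open>The edge j = n of the first copy decides the spin. The step j - 1/2 preserves it when n
  is lowered and leaves it when n is raised, which produces the only spin change in the lifted
  matrices.\<close>

lemma conjugated_action:
  fixes e :: "real \<times> real \<times> real \<Rightarrow> 'l::complex_hilbert"
    and v :: "spin \<times> real \<times> real \<times> real \<Rightarrow> 'k::complex_hilbert"
  assumes U: "bounded_clinear U" "\<And>k. k \<in> e_index <+> e_index \<Longrightarrow> U (sum_basis e e k) = v (spinor_label k)"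
    and V: "\<And>k. k \<in> e_index <+> e_index \<Longrightarrow> V (v (spinor_label k)) = sum_basis e e k"
    and P: "bounded_clinear P" "\<And>n i j. (n, i, j) \<in> e_index \<Longrightarrow>
      P (e (n, i, j)) = fp n i j *\<^sub>R e (n + 1/2, i + di, j - 1/2)
        + fm n i j *\<^sub>R e (n - 1/2, i + di, j - 1/2)"
    and di: "di = 1/2 \<or> di = -1/2"
    and fm: "\<And>n i j. (n, i, j) \<in> e_index \<Longrightarrow> (n - 1/2, i + di, j - 1/2) \<notin> e_index \<Longrightarrow> fm n i j = 0"
    and k: "(s, n, i, j) \<in> v_index"
  shows "U (map_prod P P (V (v (s, n, i, j)))) =
    column v (lift_plus fp n i j) s (n + 1/2) (i + di) (j - 1/2) +
    column v (lift_minus fm n i j) s (n - 1/2) (i + di) (j - 1/2)"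
proof -
  have lin: "U (x + y) = U x + U y" "U (r *\<^sub>R x) = r *\<^sub>R U x" "U 0 = 0" for x y r
    using U(1) unfolding bounded_clinear_def by (auto simp: linear_simps)
  have P0: "P 0 = 0" using P(1) unfolding bounded_clinear_def by (auto simp: linear_simps)
  have up: "(n + 1/2, i + di, j - 1/2) \<in> e_index" if "(n, i, j) \<in> e_index" for n i j
  proof -
    have i: "i \<in> weights n" using that by (simp add: e_index_iff)
    have "i + di = i + 1/2 \<or> i + di = i - 1/2" using di by auto
    then have "i + di \<in> weights (n + 1/2)"
      using weights_half_steps(1,2)[OF i] by metis
    then show ?thesis
      using that weights_half_steps(1) half_naturals_steps(1) by (simp add: e_index_iff)
  qed
  \<comment> \<open>Outside \<open>e_index\<close> the values of e are unconstrained, so the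
    relabelling holds there only through a zero coefficient. Raising never leaves the index set, and
    for lowering \<open>fm\<close> provides the zero.\<close>
  have shifted: "r *\<^sub>R U (sum_basis e e (c k)) = r *\<^sub>R v (spinor_label (c k))"
    if "c = Inl \<or> c = Inr" "k \<notin> e_index \<Longrightarrow> r = 0" for r c k
    using that U(2)[of "c k"] by (cases "k \<in> e_index") auto
  have L: "U (P (e (n, i, j)), 0) = fp n i j *\<^sub>R v (spinor_label (Inl (n + 1/2, i + di, j - 1/2)))
      + fm n i j *\<^sub>R v (spinor_label (Inl (n - 1/2, i + di, j - 1/2)))"
    if nij: "(n, i, j) \<in> e_index" for n i j
  proof -
    have "(P (e (n, i, j)), 0) = fp n i j *\<^sub>R sum_basis e e (Inl (n + 1/2, i + di, j - 1/2))
        + fm n i j *\<^sub>R sum_basis e e (Inl (n - 1/2, i + di, j - 1/2))"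
      by (simp add: P(2)[OF nij] prod_eq_iff)
    then show ?thesis
      using up[OF nij] fm[OF nij] by (simp only: lin) (intro arg_cong2[where f = plus] shifted; simp)
  qed
  have R: "U (0, P (e (n, i, j))) = fp n i j *\<^sub>R v (spinor_label (Inr (n + 1/2, i + di, j - 1/2)))
      + fm n i j *\<^sub>R v (spinor_label (Inr (n - 1/2, i + di, j - 1/2)))"
    if nij: "(n, i, j) \<in> e_index" for n i j
  proof -
    have "(0, P (e (n, i, j))) = fp n i j *\<^sub>R sum_basis e e (Inr (n + 1/2, i + di, j - 1/2))
        + fm n i j *\<^sub>R sum_basis e e (Inr (n - 1/2, i + di, j - 1/2))"
      by (simp add: P(2)[OF nij] prod_eq_iff)
    then show ?thesis
      using up[OF nij] fm[OF nij] by (simp only: lin) (intro arg_cong2[where f = plus] shifted; simp)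
  qed
  have Vk: "V (v (s, n, i, j)) = sum_basis e e (haar_label (s, n, i, j))"
    using V[OF haar_label_in(1)[OF k]] haar_label_in(2)[OF k] by simp
  note mem = haar_label_in(1)[OF k]
  show ?thesis
  proof (cases s)
    case Up
    show ?thesis
    proof (cases "j = n + 1/2")
      case True
      then show ?thesis
        using mem L[of n i n] Vk by (auto simp: Up column_def lift_plus_def lift_minus_def P0)
    next
      case False
      then show ?thesis
        using mem R[of n i "j + 1/2"] Vk
        by (auto simp: Up column_def lift_plus_def lift_minus_def P0)
    qed
  next
    case Down
    \<comment> \<open>The targets have label j - 1 in the first copy, below the edge of either
      level, so \<open>Down\<close> stays \<open>Down\<close>.\<close>
    have "j - 1 \<noteq> n + 1/2" "j - 1 \<noteq> n - 1/2"
      using v_index_Down(5)[of n i j] k by (auto simp: Down)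
    then show ?thesis
      using mem L[of n i "j - 1/2"] Vk
      by (auto simp: Down column_def lift_plus_def lift_minus_def P0)
  qed
qed

text \<open>Lowering leaves the index set only at n = 0 or at a bottom weight i = -n or j = -n,
  where a factor 1 - q^0 vanishes.\<close>

lemma a_minus_eq_0:
  assumes q: "0 < q" and I: "(n, i, j) \<in> e_index" "(n - 1/2, i - 1/2, j - 1/2) \<notin> e_index"
  shows "a_minus q n i j = 0"
proof -
  have "n = 0 \<or> i = - n \<or> j = - n"
    using I half_naturals_steps(2)[of n] weights_half_steps(4)[of _ n] by (auto simp: e_index_iff)
  then show ?thesis using q by (auto simp: a_minus_def)
qed

lemma b_minus_eq_0:
  assumes q: "0 < q" and I: "(n, i, j) \<in> e_index" "(n - 1/2, i + 1/2, j - 1/2) \<notin> e_index"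
  shows "b_minus q n i j = 0"
proof -
  have "n = 0 \<or> i = n \<or> j = - n"
    using I half_naturals_steps(2)[of n] weights_half_steps(3)[of n i] weights_half_steps(4)[of j n]
      half_naturalsD[of n] by (auto simp: e_index_iff)
  then show ?thesis using q by (auto simp: b_minus_def)
qed

section \<open>Elementary properties of representations and columns\<close>

lemma star_representation_adjoint:
  "star_representation \<rho> \<Longrightarrow> adjoint_pair (\<rho> a) (\<rho> (star a))"
  unfolding star_representation_def adjoint_pair_def by (metis star_star)

lemma star_representation_uminus:
  assumes "star_representation \<rho>"
  shows "\<rho> (- a) x = - \<rho> a x"
proof -
  have "\<rho> 0 x = 0"
    using assms scaleC_zero_left[of "a"] scaleC_zero_left unfolding star_representation_def by metis
  moreover have "\<rho> (- a + a) x = \<rho> (- a) x + \<rho> a x"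
    using assms unfolding star_representation_def by blast
  ultimately show ?thesis by (simp add: eq_neg_iff_add_eq_0)
qed

lemma bounded_clinear_map_prod:
  fixes P :: "'l::complex_hilbert \<Rightarrow> 'l"
  assumes "bounded_clinear P"
  shows "bounded_clinear (map_prod P P)"
proof -
  have P: "bounded_linear P" using assms by (simp add: bounded_clinear_def)
  have "bounded_linear (\<lambda>x. (P (fst x), P (snd x)))"
    by (intro bounded_linear_Pair bounded_linear_compose[OF P] bounded_linear_fst bounded_linear_snd)
  then show ?thesis
    using assms by (simp add: bounded_clinear_def map_prod_def scaleC_prod_def case_prod_unfold)
qed

lemma column_diff:
  "column v (m n i j) s n' i' j' - column v (m' n i j) s n' i' j'
    = column v (\<lambda>t s. m n i j t s - m' n i j t s) s n' i' j'"
  by (simp add: column_def scaleR_diff_left)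

lemma column_add:
  "column v (m n i j) s n' i' j' + column v (m' n i j) s n' i' j'
    = column v (\<lambda>t s. m n i j t s + m' n i j t s) s n' i' j'"
  by (simp add: column_def scaleR_add_left)

theorem theorem3p2:
  fixes q :: real
    and \<alpha> \<beta> :: "'a::cstar_algebra"
    and h :: "'a \<Rightarrow> complex"
    and \<pi> :: "'a \<Rightarrow> 'l::complex_hilbert \<Rightarrow> 'l"
    and \<Omega> :: 'l
    and e :: "real \<times> real \<times> real \<Rightarrow> 'l"
    and v :: "spin \<times> real \<times> real \<times> real \<Rightarrow> 'k::complex_hilbert"
    and \<pi>' :: "'a \<Rightarrow> 'k \<Rightarrow> 'k"
  assumes "0 < q" and "q < 1"
    and "universal_SUq2 TYPE('b::cstar_algebra) q \<alpha> \<beta>"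
    and "haar_state q \<alpha> \<beta> h"
    and "gns_triple h \<pi> \<Omega>"
    and "standard_basis q \<alpha> \<beta> \<pi> \<Omega> e"
    and "spinor_basis v"
    and "spinor_representation q \<alpha> \<beta> v \<pi>'"
  defines "D1 \<equiv> diagonal_graph e_index e D1_eigenvalue"
    and "D2 \<equiv> diagonal_graph e_index e D2_eigenvalue"
    and "D \<equiv> diagonal_graph v_index v D_eigenvalue"
  shows "\<exists>U :: 'l \<times> 'l \<Rightarrow> 'k. unitary_op U \<and>
    conjugate_graph U (direct_sum_graph D1 (abs_graph D2)) = D \<and>
    (\<forall>a\<in>star_subalgebra {\<alpha>, \<beta>}.
      (\<lambda>x. (U \<circ> map_prod (\<pi> a) (\<pi> a) \<circ> adjoint_op U) x - \<pi>' a x) \<in> ideal_Kq q v)"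
proof -
  note q = assms(1,2)
  have e: "orthonormal_basis e_index e" and v: "orthonormal_basis v_index v"
    using assms(6,7) by (auto simp: standard_basis_def spinor_basis_def)
  have \<pi>: "star_representation \<pi>" and \<pi>': "star_representation \<pi>'"
    using assms(5,8) by (auto simp: gns_triple_def spinor_representation_def)
  obtain U where U: "bounded_clinear U" "bounded_clinear (adjoint_op U)"
    "adjoint_pair U (adjoint_op U)" "unitary_op U"
    "\<forall>k\<in>e_index <+> e_index. U (sum_basis e e k) = v (spinor_label k)"
    "\<forall>k\<in>e_index <+> e_index. adjoint_op U (v (spinor_label k)) = sum_basis e e k"
    using basis_bijection_unitary[OF orthonormal_sum_basis[OF e e] v bij_betw_spinor_label] by blast
  have UU: "adjoint_op U (U x) = x" for x
    using U(4) unfolding unitary_op_def by (metis comp_apply id_apply)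
  have D2_abs: "abs_graph D2 = diagonal_graph e_index e (\<lambda>k. \<bar>D2_eigenvalue k\<bar>)"
    unfolding D2_def by (rule abs_diagonal_graph[OF e]) (rule D2_eigenvalue_nonzero)
  have D: "conjugate_graph U (direct_sum_graph D1 (abs_graph D2)) = D"
    unfolding D1_def D_def D2_abs direct_sum_diagonal_graph
    using bij_betw_spinor_label U D_eigenvalue_spinor_label
    by (intro conjugate_diagonal_graph[OF v _ U(3,4)]) (auto simp: bij_betw_def)

  define L where "L a = U \<circ> map_prod (\<pi> a) (\<pi> a) \<circ> adjoint_op U" for a
  define X where "X a x = L a x - \<pi>' a x" for a x
  have bL: "bounded_clinear (L a)" and b': "bounded_clinear (\<pi>' a)" for a
    using \<pi> \<pi>' U(1,2) unfolding L_def star_representation_def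
    by (auto intro!: bounded_clinear_compose bounded_clinear_map_prod)
  have bX: "bounded_clinear (X a)" for a
    unfolding X_def[abs_def] by (intro bounded_clinear_diff bL b')
  \<comment> \<open>Conjugation by the unitary and both representations respect adjoints, so the
    estimates for one generator also settle its star.\<close>
  have adjX: "adjoint_pair (X a) (X (star a))" for a
  proof -
    have "cinner (map_prod (\<pi> a) (\<pi> a) x) y = cinner x (map_prod (\<pi> (star a)) (\<pi> (star a)) y)" for x y
      using star_representation_adjoint[OF \<pi>, of a]
      by (simp add: adjoint_pair_def cinner_prod_def map_prod_def case_prod_unfold)
    moreover have "cinner (adjoint_op U x) y = cinner x (U y)" for x y
      using adjoint_pair_commute[OF U(3)] unfolding adjoint_pair_def by blast
    moreover have "cinner (U x) y = cinner x (adjoint_op U y)" for x y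
      using U(3) unfolding adjoint_pair_def by blast
    ultimately show ?thesis
      using star_representation_adjoint[OF \<pi>', of a]
      by (simp add: adjoint_pair_def X_def L_def cinner_diff_left cinner_diff_right)
  qed

  \<comment> \<open>The constant is the factor 3 of the four entry bounds over the denominator of
    \<open>entry_bound\<close>.\<close>
  let ?K = "ideal_Kq q v" and ?C = "3 / (1 - q\<^sup>2)\<^sup>2"
  have bound: "3 * entry_bound q n = ?C * q powr n" for n
    by (simp add: entry_bound_def)
  have \<alpha>: "X \<alpha> \<in> ?K" "X (star \<alpha>) \<in> ?K"
  proof -
    have "X \<alpha> (v (s, n, i, j)) =
        column v (\<lambda>t s. lift_plus (a_plus q) n i j t s - mat_a_plus' q n i j t s)
          s (n + 1/2) (i + -1/2) (j + -1/2)
        + column v (\<lambda>t s. lift_minus (a_minus q) n i j t s - mat_a_minus' q n i j t s)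
          s (n - 1/2) (i + -1/2) (j + -1/2)" if k: "(s, n, i, j) \<in> v_index" for s n i j
    proof -
      have "L \<alpha> (v (s, n, i, j)) =
          column v (lift_plus (a_plus q) n i j) s (n + 1/2) (i + -1/2) (j - 1/2) +
          column v (lift_minus (a_minus q) n i j) s (n - 1/2) (i + -1/2) (j - 1/2)"
        unfolding L_def comp_apply
        using assms(6) a_minus_eq_0[OF q(1)] \<pi> U k
        by (intro conjugated_action[where e = e and v = v])
          (auto simp: standard_basis_def star_representation_def)
      moreover have "\<pi>' \<alpha> (v (s, n, i, j)) =
          column v (mat_a_plus' q n i j) s (n + 1/2) (i - 1/2) (j - 1/2)
        + column v (mat_a_minus' q n i j) s (n - 1/2) (i - 1/2) (j - 1/2)"
        using assms(8) k unfolding spinor_representation_def by fast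
      ultimately show ?thesis by (simp add: X_def column_diff[symmetric])
    qed
    from band_operator_in_ideal_Kq[OF q assms(7) bX adjX this, of ?C]
    show "X \<alpha> \<in> ?K" "X (star \<alpha>) \<in> ?K"
      using alpha_plus_bound[OF q] alpha_minus_bound[OF q] by (simp_all add: bound)
  qed
  have \<beta>: "X \<beta> \<in> ?K" "X (star \<beta>) \<in> ?K"
  proof -
    have "X \<beta> (v (s, n, i, j)) =
        column v (\<lambda>t s. lift_plus (b_plus q) n i j t s + mat_b_plus q n i j t s)
          s (n + 1/2) (i + 1/2) (j + -1/2)
        + column v (\<lambda>t s. lift_minus (b_minus q) n i j t s + mat_b_minus q n i j t s)
          s (n - 1/2) (i + 1/2) (j + -1/2)" if k: "(s, n, i, j) \<in> v_index" for s n i j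
    proof -
      have "L \<beta> (v (s, n, i, j)) =
          column v (lift_plus (b_plus q) n i j) s (n + 1/2) (i + 1/2) (j - 1/2) +
          column v (lift_minus (b_minus q) n i j) s (n - 1/2) (i + 1/2) (j - 1/2)"
        unfolding L_def comp_apply
        using assms(6) b_minus_eq_0[OF q(1)] \<pi> U k
        by (intro conjugated_action[where e = e and v = v])
          (auto simp: standard_basis_def star_representation_def)
      moreover have "\<pi>' (- \<beta>) (v (s, n, i, j)) =
          column v (mat_b_plus q n i j) s (n + 1/2) (i + 1/2) (j - 1/2)
        + column v (mat_b_minus q n i j) s (n - 1/2) (i + 1/2) (j - 1/2)"
        using assms(8) k unfolding spinor_representation_def by fast
      \<comment> \<open>Rewriting through \<open>- \<beta>\<close> matches the given matrices and
        yields the sums estimated by the bounds for \<open>\<beta>\<close>.\<close>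
      moreover have "X \<beta> x = L \<beta> x + \<pi>' (- \<beta>) x" for x
        by (simp add: X_def star_representation_uminus[OF \<pi>'])
      ultimately show ?thesis by (simp add: column_add[symmetric])
    qed
    from band_operator_in_ideal_Kq[OF q assms(7) bX adjX this, of ?C]
    show "X \<beta> \<in> ?K" "X (star \<beta>) \<in> ?K"
      using beta_plus_bound[OF q] beta_minus_bound[OF q] by (simp_all add: bound)
  qed

  have L_mult: "L (a * b) = L a \<circ> L b" for a b
  proof -
    have "\<pi> (a * b) = \<pi> a \<circ> \<pi> b" using \<pi> unfolding star_representation_def by blast
    then have "map_prod (\<pi> (a * b)) (\<pi> (a * b)) x = map_prod (\<pi> a) (\<pi> a) (map_prod (\<pi> b) (\<pi> b) x)"
      for x by (cases x) simp
    then show ?thesis by (simp add: L_def fun_eq_iff UU)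
  qed
  have lin: "bounded_linear U" "bounded_linear (\<pi>' a)" for a
    using U(1) b' by (simp_all add: bounded_clinear_def)
  have X_add: "X (a + b) = (\<lambda>x. X a x + X b x)" for a b
  proof -
    have "map_prod (\<pi> (a + b)) (\<pi> (a + b)) x = map_prod (\<pi> a) (\<pi> a) x + map_prod (\<pi> b) (\<pi> b) x" for x
      using \<pi> by (simp add: star_representation_def map_prod_def case_prod_unfold)
    moreover have "\<pi>' (a + b) x = \<pi>' a x + \<pi>' b x" for x
      using \<pi>' by (simp add: star_representation_def)
    ultimately show ?thesis by (simp add: X_def L_def fun_eq_iff linear_simps[OF lin(1)])
  qed
  have X_scale: "X (c *\<^sub>C a) = (\<lambda>x. c *\<^sub>C x) \<circ> X a" for c a
  proof -
    have "map_prod (\<pi> (c *\<^sub>C a)) (\<pi> (c *\<^sub>C a)) x = c *\<^sub>C map_prod (\<pi> a) (\<pi> a) x" for x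
      using \<pi> by (simp add: star_representation_def map_prod_def case_prod_unfold scaleC_prod_def)
    moreover have "\<pi>' (c *\<^sub>C a) x = c *\<^sub>C \<pi>' a x" for x
      using \<pi>' by (simp add: star_representation_def)
    moreover have "U (c *\<^sub>C x) = c *\<^sub>C U x" for x
      using U(1) unfolding bounded_clinear_def by blast
    ultimately show ?thesis by (simp add: X_def L_def fun_eq_iff scaleC_diff_right)
  qed
  have X_mult: "X (a * b) = (\<lambda>x. (X a \<circ> L b) x + (\<pi>' a \<circ> X b) x)" for a b
  proof -
    have "\<pi>' (a * b) = \<pi>' a \<circ> \<pi>' b" using \<pi>' unfolding star_representation_def by blast
    then show ?thesis by (simp add: X_def L_mult fun_eq_iff linear_simps[OF lin(2)])
  qed
  have K_add: "X (a + b) \<in> ?K" if "X a \<in> ?K" "X b \<in> ?K" for a b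
    using that unfolding ideal_Kq_def X_add by (rule ideal_generated.add)
  have K_scale: "X (c *\<^sub>C a) \<in> ?K" if "X a \<in> ?K" for c a
    using that unfolding ideal_Kq_def X_scale
    by (intro ideal_generated.mult_left bounded_clinear_scaleC)
  have K_mult: "X (a * b) \<in> ?K" if "X a \<in> ?K" "X b \<in> ?K" for a b
    using that unfolding ideal_Kq_def X_mult
    by (intro ideal_generated.add ideal_generated.mult_left ideal_generated.mult_right bL b')
  have K_zero: "X 0 \<in> ?K"
    using K_scale[OF \<alpha>(1), of 0] by simp
  have star_zero: "star (0::'a) = 0"
    using star_scaleC[of 0 "0::'a"] by simp
  \<comment> \<open>Both memberships are carried through the induction: closure under adjoints is
    not among the rules of the ideal, and with the pair the \<open>star\<close> case is a mere
    exchange.\<close>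
  have "X a \<in> ?K \<and> X (star a) \<in> ?K" if "a \<in> star_subalgebra {\<alpha>, \<beta>}" for a
    using that
    by induction
      (auto simp: \<alpha> \<beta> K_zero star_zero star_add star_scaleC star_mult star_star
        intro: K_add K_scale K_mult)
  then have "\<forall>a\<in>star_subalgebra {\<alpha>, \<beta>}. (\<lambda>x. (U \<circ> map_prod (\<pi> a) (\<pi> a) \<circ> adjoint_op U) x - \<pi>' a x) \<in> ?K"
    unfolding X_def[abs_def] L_def by blast
  with U(4) D show ?thesis by blast
qed

end
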